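(* Let $k$ be an algebraically closed field of characteristic zero and let $X\subset\mathbb{P}^N$ be a nonempty closed subscheme over $k$. If $X$ is contained in the $r$th thickening of a hyperplane for some integer $r\ge 1$, then $X$ is $m$-Hilbert unstable for every positive integer $m>(N+1)(r-1)$ (for which the $m$th Hilbert point of $X$ is defined). In particular, if $X$ is a reduced degenerate variety, then $X$ is $m$-Hilbert unstable for all positive integers $m$ (for which the $m$th Hilbert point of $X$ is defined).
   Context: The $r$th thickening of a hyperplane $\{\ell=0\}$ is the closed subscheme $\{\ell^r=0\}\subset\mathbb{P}^N$. A variety in $\mathbb{P}^N$ is degenerate if it is contained in a hyperplane. Let $I\subset S=k[x_0,\dots,x_N]$ be the (saturated) homogeneous ideal of $X$ and $P$ its Hilbert polynomial. The $m$th Hilbert point $[X]_m$ is defined when $S_m\to H^0(X,\mathcal{O}_X(m))$ is surjective and $h^0(X,\mathcal{O}_X(m))=P(m)$, so that $\dim (S/I)_m=P(m)$; it is the point of $\mathbb{P}(\bigwedge^{P(m)}S_m)$ given by the one-dimensional quotient $$\textstyle\bigwedge^{P(m)}S_m\to\bigwedge^{P(m)}(S/I)_m.$$ $X$ is $m$-Hilbert unstable if $[X]_m$ is not GIT semistable for the natural $SL_{N+1}(k)$-action (by linear changes of coordinates) linearized by $\mathcal{O}(1)$ on this projective space. *)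

theory Defs
  imports
    "HOL-Analysis.Determinants"
    "HOL-Computational_Algebra.Polynomial"
    "HOL-Library.Poly_Mapping"
begin

section \<open>Vector spaces of finitely supported functions, dimensions of quotients\<close>

abbreviation lookup :: "('a \<Rightarrow>\<^sub>0 'b::zero) \<Rightarrow> 'a \<Rightarrow> 'b"
  where "lookup \<equiv> Poly_Mapping.lookup"

abbreviation keys :: "('a \<Rightarrow>\<^sub>0 'b::zero) \<Rightarrow> 'a set"
  where "keys \<equiv> Poly_Mapping.keys"

definition pm_scale :: "'k::field \<Rightarrow> ('a \<Rightarrow>\<^sub>0 'k) \<Rightarrow> ('a \<Rightarrow>\<^sub>0 'k)"
  where "pm_scale c f = Poly_Mapping.map ((*) c) f"

lemma lookup_pm_scale [simp]: "lookup (pm_scale c f) a = c * lookup f a"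
  by (simp add: pm_scale_def Poly_Mapping.map.rep_eq when_def)

interpretation pm: vector_space "pm_scale :: 'k::field \<Rightarrow> ('a \<Rightarrow>\<^sub>0 'k) \<Rightarrow> ('a \<Rightarrow>\<^sub>0 'k)"
  by unfold_locales (auto intro!: poly_mapping_eqI simp: lookup_add algebra_simps)

text \<open>The linear extension of a map \<open>\<phi>\<close> between bases.\<close>

definition push :: "('a \<Rightarrow> 'b) \<Rightarrow> ('a \<Rightarrow>\<^sub>0 'k::field) \<Rightarrow> ('b \<Rightarrow>\<^sub>0 'k)"
  where "push \<phi> f = (\<Sum>a\<in>keys f. Poly_Mapping.single (\<phi> a) (lookup f a))"

text \<open>\<open>has_quot_dim sc U W d\<close>: the quotient space \<open>U / (U \<inter> W)\<close> has dimension \<open>d\<close>, that is,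
  some \<open>d\<close>-element \<open>B \<subseteq> U\<close> maps bijectively onto a basis of it.\<close>

definition has_quot_dim ::
    "('k::field \<Rightarrow> 'v::ab_group_add \<Rightarrow> 'v) \<Rightarrow> 'v set \<Rightarrow> 'v set \<Rightarrow> nat \<Rightarrow> bool"
  where "has_quot_dim sc U W d \<longleftrightarrow>
    (\<exists>B\<subseteq>U. finite B \<and> card B = d \<and>
      (\<forall>u\<in>U. \<exists>c. u - (\<Sum>b\<in>B. sc (c b) b) \<in> W) \<and>
      (\<forall>c. (\<Sum>b\<in>B. sc (c b) b) \<in> W \<longrightarrow> (\<forall>b\<in>B. c b = 0)))"


section \<open>Homogeneous ideals and closed subschemes of projective space\<close>

text \<open>The homogeneous coordinate ring \<open>S\<close> of the projective space with coordinates indexed by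
  \<open>'n\<close>; hence \<open>N + 1 = CARD('n)\<close>.\<close>

type_synonym ('n, 'k) mpoly = "('n \<Rightarrow>\<^sub>0 nat) \<Rightarrow>\<^sub>0 'k"

definition mdeg :: "('n::finite \<Rightarrow>\<^sub>0 'z::comm_monoid_add) \<Rightarrow> 'z"
  where "mdeg a = (\<Sum>i\<in>UNIV. lookup a i)"

definition var :: "'n \<Rightarrow> ('n, 'k::field) mpoly"
  where "var i = Poly_Mapping.single (Poly_Mapping.single i 1) 1"

definition hom_polys :: "nat \<Rightarrow> ('n::finite, 'k::field) mpoly set"
  where "hom_polys m = {f. \<forall>a\<in>keys f. mdeg a = m}"

definition hom_part :: "nat \<Rightarrow> ('n::finite, 'k::field) mpoly \<Rightarrow> ('n, 'k) mpoly"
  where "hom_part m f = (\<Sum>a\<in>{a\<in>keys f. mdeg a = m}. Poly_Mapping.single a (lookup f a))"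

text \<open>An ideal is a submodule of the ring over itself.\<close>

definition homogeneous_ideal :: "('n::finite, 'k::field) mpoly set \<Rightarrow> bool"
  where "homogeneous_ideal I \<longleftrightarrow>
    module.subspace (*) I \<and> (\<forall>f\<in>I. \<forall>m. hom_part m f \<in> I)"

text \<open>Closed subschemes of projective space correspond bijectively to saturated homogeneous ideals
  and are represented by them throughout.\<close>

definition saturated :: "('n::finite, 'k::field) mpoly set \<Rightarrow> bool"
  where "saturated I \<longleftrightarrow> (\<forall>f. (\<exists>e. \<forall>g\<in>hom_polys e. g * f \<in> I) \<longrightarrow> f \<in> I)"

definition closed_subscheme :: "('n::finite, 'k::field) mpoly set \<Rightarrow> bool"
  where "closed_subscheme I \<longleftrightarrow> homogeneous_ideal I \<and> saturated I"

text \<open>The points of \<open>Proj (S/I)\<close>, as homogeneous primes of \<open>S\<close>.\<close>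

definition proj_points :: "('n::finite, 'k::field) mpoly set \<Rightarrow> ('n, 'k) mpoly set set"
  where "proj_points I =
    {p. homogeneous_ideal p \<and> p \<noteq> UNIV \<and> (\<forall>f g. f * g \<in> p \<longrightarrow> f \<in> p \<or> g \<in> p) \<and>
        I \<subseteq> p \<and> (\<exists>i. var i \<notin> p)}"

definition hyperplane_form :: "('n::finite, 'k::field) mpoly \<Rightarrow> bool"
  where "hyperplane_form l \<longleftrightarrow> l \<in> hom_polys 1 \<and> l \<noteq> 0"

text \<open>Since \<open>I\<close> is saturated, \<open>Proj (S/I)\<close> is a closed subscheme of \<open>{l ^ r = 0}\<close> if and only if
  the form \<open>l ^ r\<close> lies in \<open>I\<close>.\<close>

definition in_thickening ::
    "('n::finite, 'k::field) mpoly set \<Rightarrow> ('n, 'k) mpoly \<Rightarrow> nat \<Rightarrow> bool"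
  where "in_thickening I l r \<longleftrightarrow> l ^ r \<in> I"

text \<open>Containment in a hyperplane is meant on the level of points.  For reduced subschemes it is the
  same as containment as a subscheme.\<close>

definition degenerate :: "('n::finite, 'k::field) mpoly set \<Rightarrow> bool"
  where "degenerate I \<longleftrightarrow> (\<exists>l. hyperplane_form l \<and> (\<forall>p\<in>proj_points I. l \<in> p))"


section \<open>Twisted structure sheaves and the Hilbert polynomial\<close>

text \<open>All localizations of \<open>S\<close> at products of coordinates are subrings of the ring of Laurent
  polynomials: \<open>loc_part T e\<close> is the degree \<open>e\<close> part of \<open>S\<close> localized at the coordinates in \<open>T\<close>, and
  \<open>loc_ideal T I\<close> is the ideal generated by \<open>I\<close> in that localization.\<close>

type_synonym ('n, 'k) laurent = "('n \<Rightarrow>\<^sub>0 int) \<Rightarrow>\<^sub>0 'k"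

definition to_laurent :: "('n, 'k::field) mpoly \<Rightarrow> ('n, 'k) laurent"
  where "to_laurent = push (Poly_Mapping.map int)"

definition loc_part :: "'n set \<Rightarrow> int \<Rightarrow> ('n::finite, 'k::field) laurent set"
  where "loc_part T e =
    {s. \<forall>a\<in>keys s. mdeg a = e \<and> (\<forall>i. i \<notin> T \<longrightarrow> 0 \<le> lookup a i)}"

definition loc_ideal :: "'n set \<Rightarrow> ('n::finite, 'k::field) mpoly set \<Rightarrow> ('n, 'k) laurent set"
  where "loc_ideal T I =
    {Poly_Mapping.single a 1 * to_laurent f | a f. keys a \<subseteq> T \<and> f \<in> I}"

text \<open>\<open>X = Proj (S/I)\<close> is reduced: the coordinate rings of its standard affine charts, the degree
  \<open>0\<close> parts of the localizations of \<open>S/I\<close>, have no nonzero nilpotents.\<close>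

definition reduced_scheme :: "('n::finite, 'k::field) mpoly set \<Rightarrow> bool"
  where "reduced_scheme I \<longleftrightarrow>
    (\<forall>i. \<forall>s\<in>loc_part {i} 0. \<forall>n. s ^ n \<in> loc_ideal {i} I \<longrightarrow> s \<in> loc_ideal {i} I)"

text \<open>A global section of \<open>O_X(m)\<close> is a family of sections over the standard affine charts that agree
  on the overlaps.  Thus \<open>H\<^sup>0(X, O_X(m))\<close> is the quotient of \<open>twist_sections I m\<close> by
  \<open>twist_null I m\<close>.\<close>

definition twist_sections ::
    "('n::finite, 'k::field) mpoly set \<Rightarrow> nat \<Rightarrow> (('n, 'k) laurent ^ 'n) set"
  where "twist_sections I m =
    {s. (\<forall>i. s $ i \<in> loc_part {i} (int m)) \<and> (\<forall>i j. s $ i - s $ j \<in> loc_ideal {i, j} I)}"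

definition twist_null ::
    "('n::finite, 'k::field) mpoly set \<Rightarrow> nat \<Rightarrow> (('n, 'k) laurent ^ 'n) set"
  where "twist_null I m =
    {s. \<forall>i. s $ i \<in> loc_part {i} (int m) \<and> s $ i \<in> loc_ideal {i} I}"

definition tuple_scale :: "'k::field \<Rightarrow> ('n, 'k) laurent ^ 'n \<Rightarrow> ('n::finite, 'k) laurent ^ 'n"
  where "tuple_scale c s = (\<chi> i. pm_scale c (s $ i))"

definition hilbert_polynomial :: "('n::finite, 'k::field) mpoly set \<Rightarrow> rat poly"
  where "hilbert_polynomial I =
    (THE P. \<exists>n0. \<forall>n\<ge>n0. \<exists>d. has_quot_dim pm_scale (hom_polys n) (I \<inter> hom_polys n) d \<and>
                            poly P (of_nat n) = of_nat d)"

definition hilbert_point_defined :: "('n::finite, 'k::field) mpoly set \<Rightarrow> nat \<Rightarrow> bool"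
  where "hilbert_point_defined I m \<longleftrightarrow>
    (\<forall>s\<in>twist_sections I m. \<exists>f\<in>hom_polys m. s - (\<chi> i. to_laurent f) \<in> twist_null I m) \<and>
    (\<exists>d. has_quot_dim tuple_scale (twist_sections I m) (twist_null I m) d \<and>
         of_nat d = poly (hilbert_polynomial I) (of_nat m))"


section \<open>Exterior powers\<close>

text \<open>For subspaces \<open>U \<subseteq> W\<close>, the \<open>d\<close>-th exterior power of \<open>W/U\<close> is the free vector space
  \<open>wedge_free d W\<close> on \<open>d\<close>-tuples of vectors of \<open>W\<close>, modulo the subspace \<open>wedge_rels d W U\<close> spanned
  by the relations of multilinearity, alternation, and congruence modulo \<open>U\<close>.  For \<open>U = {0}\<close> this is
  the exterior power of \<open>W\<close>.\<close>

definition tuples :: "nat \<Rightarrow> 'v set \<Rightarrow> 'v list set"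
  where "tuples d W = {xs. length xs = d \<and> set xs \<subseteq> W}"

definition wedge_free :: "nat \<Rightarrow> ('a \<Rightarrow>\<^sub>0 'k::field) set \<Rightarrow> (('a \<Rightarrow>\<^sub>0 'k) list \<Rightarrow>\<^sub>0 'k) set"
  where "wedge_free d W = {\<xi>. keys \<xi> \<subseteq> tuples d W}"

definition wedge_rels ::
    "nat \<Rightarrow> ('a \<Rightarrow>\<^sub>0 'k::field) set \<Rightarrow> ('a \<Rightarrow>\<^sub>0 'k) set \<Rightarrow> (('a \<Rightarrow>\<^sub>0 'k) list \<Rightarrow>\<^sub>0 'k) set"
  where "wedge_rels d W U = pm.span
    ({Poly_Mapping.single (xs @ (pm_scale a u + pm_scale b v) # ys) 1
        - Poly_Mapping.single (xs @ u # ys) a - Poly_Mapping.single (xs @ v # ys) b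
        | xs ys a b u v. xs @ u # ys \<in> tuples d W \<and> xs @ v # ys \<in> tuples d W} \<union>
     {Poly_Mapping.single xs 1 | xs. xs \<in> tuples d W \<and> \<not> distinct xs} \<union>
     {Poly_Mapping.single (xs @ u # ys) 1 - Poly_Mapping.single (xs @ v # ys) 1
        | xs ys u v. xs @ u # ys \<in> tuples d W \<and> xs @ v # ys \<in> tuples d W \<and> u - v \<in> U})"


section \<open>GIT semistability on a projective space of one-dimensional quotients\<close>

text \<open>Let \<open>V = E / R\<close>.  Linear forms on \<open>V\<close> are linear forms \<open>q\<close> on \<open>E\<close> vanishing on \<open>R\<close> (here
  extended arbitrarily to the whole type).  The global sections of \<open>O(n)\<close> on \<open>P(V)\<close> are the elements
  of \<open>Sym\<^sup>n V\<close>, i.e. the homogeneous polynomial functions of degree \<open>n\<close> on the dual of \<open>V\<close>: linear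
  combinations of products of \<open>n\<close> vectors evaluated at \<open>q\<close>.  Such functions are only ever considered
  on \<open>linear_forms R\<close>.\<close>

definition linear_forms :: "('b \<Rightarrow>\<^sub>0 'k::field) set \<Rightarrow> (('b \<Rightarrow>\<^sub>0 'k) \<Rightarrow> 'k) set"
  where "linear_forms R = {q. Vector_Spaces.linear pm_scale (*) q \<and> (\<forall>\<xi>\<in>R. q \<xi> = 0)}"

definition sym_power :: "nat \<Rightarrow> ('b \<Rightarrow>\<^sub>0 'k::field) set \<Rightarrow> ((('b \<Rightarrow>\<^sub>0 'k) \<Rightarrow> 'k) \<Rightarrow> 'k) set"
  where "sym_power n E =
    {\<lambda>q. \<Sum>vs\<in>keys c. lookup c vs * (\<Prod>v\<leftarrow>vs. q v) | c. keys c \<subseteq> tuples n E}"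

text \<open>A point of \<open>P(V)\<close>, a one-dimensional quotient of \<open>V = E / R\<close> up to isomorphism, is given by the
  kernel \<open>K \<subseteq> E\<close> of the composite map from \<open>E\<close>.  A section does not vanish at this point iff it is
  nonzero at a linear form with kernel \<open>K\<close>.  The group is given by the set \<open>G\<close> of its actions on \<open>E\<close>.\<close>

definition git_semistable ::
    "(('b \<Rightarrow>\<^sub>0 'k::field) \<Rightarrow> ('b \<Rightarrow>\<^sub>0 'k)) set \<Rightarrow>
      ('b \<Rightarrow>\<^sub>0 'k) set \<Rightarrow> ('b \<Rightarrow>\<^sub>0 'k) set \<Rightarrow> ('b \<Rightarrow>\<^sub>0 'k) set \<Rightarrow> bool"
  where "git_semistable G E R K \<longleftrightarrow>
    (\<exists>n>0. \<exists>F\<in>sym_power n E.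
      (\<forall>g\<in>G. \<forall>q\<in>linear_forms R. F (q \<circ> g) = F q) \<and>
      (\<exists>q\<in>linear_forms R. {\<xi>\<in>E. q \<xi> = 0} = K \<and> F q \<noteq> 0))"


section \<open>Hilbert points\<close>

text \<open>The linear change of coordinates sending \<open>x_i\<close> to \<open>\<Sum>j. A_ij x_j\<close>.  The convention (\<open>A\<close>, its
  inverse or its transpose) is immaterial, as only invariance under the whole group is used.\<close>

definition lin_subst :: "'k ^ 'n ^ 'n \<Rightarrow> ('n::finite, 'k::field) mpoly \<Rightarrow> ('n, 'k) mpoly"
  where "lin_subst A f =
    (\<Sum>a\<in>keys f. pm_scale (lookup f a)
       (\<Prod>i\<in>UNIV. (\<Sum>j\<in>UNIV. pm_scale (A $ i $ j) (var j)) ^ lookup a i))"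

definition SL_action ::
    "((('n::finite, 'k::field) mpoly list \<Rightarrow>\<^sub>0 'k) \<Rightarrow> (('n, 'k) mpoly list \<Rightarrow>\<^sub>0 'k)) set"
  where "SL_action = {push (map (lin_subst A)) | A. det A = 1}"

text \<open>If the \<open>m\<close>-th Hilbert point is defined, then \<open>P(m)\<close> is a natural number.\<close>

definition hilbert_value :: "('n::finite, 'k::field) mpoly set \<Rightarrow> nat \<Rightarrow> nat"
  where "hilbert_value I m = nat \<lfloor>poly (hilbert_polynomial I) (of_nat m)\<rfloor>"

text \<open>The \<open>m\<close>-th Hilbert point, as the kernel of the quotient map from the exterior power of \<open>S_m\<close> to
  that of \<open>(S/I)_m\<close> (composed with the map from the free space).\<close>

definition hilbert_point ::
    "('n::finite, 'k::field) mpoly set \<Rightarrow> nat \<Rightarrow> (('n, 'k) mpoly list \<Rightarrow>\<^sub>0 'k) set"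
  where "hilbert_point I m = wedge_rels (hilbert_value I m) (hom_polys m) (I \<inter> hom_polys m)"

definition hilbert_unstable :: "('n::finite, 'k::field) mpoly set \<Rightarrow> nat \<Rightarrow> bool"
  where "hilbert_unstable I m \<longleftrightarrow>
    \<not> git_semistable SL_action
        (wedge_free (hilbert_value I m) (hom_polys m))
        (wedge_rels (hilbert_value I m) (hom_polys m) {0})
        (hilbert_point I m)"

end

theory Submission
  imports Defs
begin

text \<open>Choose linear coordinates in which the hyperplane is the vanishing locus of the coordinate \<open>l\<close>,
  and let \<open>\<lambda>(s)\<close> multiply \<open>l\<close> by \<open>s\<^sup>-\<^sup>N\<close> and the other \<open>N\<close> coordinates by \<open>s\<close>.  A monomial of degree \<open>m\<close> containing
  \<open>l\<close> to the power \<open>a\<close> has weight \<open>m - (N + 1) a\<close>.  It vanishes in \<open>S/I\<close> for \<open>a \<ge> r\<close>, and its weight is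
  positive for \<open>a \<le> r - 1\<close>.  So every nonzero coordinate of the Hilbert point in the
  corresponding basis of the exterior power has positive weight, and every invariant of positive degree
  vanishes as \<open>s \<rightarrow> 0\<close>, hence identically.  There is at least one factor in the exterior power since
  \<open>X\<close> is nonempty.

  If \<open>X\<close> is reduced and \<open>l\<close> vanishes at all its points, then \<open>l\<close> is nilpotent on every standard chart
  (by a homogeneous prime avoiding the powers of \<open>l x\<^sub>i\<close>), hence zero there, and \<open>l \<in> I\<close> by saturation;
  so \<open>r = 1\<close> applies.\<close>

section \<open>Ideals\<close>

lemma subspace_mult_iff:
  "module.subspace ((*) :: 'a::comm_ring_1 \<Rightarrow> _) I \<longleftrightarrow>
    0 \<in> I \<and> (\<forall>x\<in>I. \<forall>y\<in>I. x + y \<in> I) \<and> (\<forall>c. \<forall>x\<in>I. c * x \<in> I)"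
proof -
  have "module ((*) :: 'a \<Rightarrow> _)"
    by unfold_locales (auto simp: algebra_simps)
  then show ?thesis by (auto simp: module.subspace_def)
qed

lemma ideal_sum:
  fixes I :: "'a::comm_ring_1 set"
  assumes "module.subspace (*) I" "\<And>a. a \<in> A \<Longrightarrow> f a \<in> I"
  shows "(\<Sum>a\<in>A. f a) \<in> I"
  using assms by (induction A rule: infinite_finite_induct) (auto simp: subspace_mult_iff)

lemma ideal_mult:
  fixes I :: "'a::comm_ring_1 set"
  assumes "module.subspace (*) I" "x \<in> I"
  shows "c * x \<in> I" "x * c \<in> I"
  using assms by (auto simp: subspace_mult_iff mult.commute)

lemma ideal_diff:
  fixes I :: "'a::comm_ring_1 set"
  assumes "module.subspace (*) I" "x \<in> I" "y \<in> I"
  shows "x - y \<in> I"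
  using assms ideal_mult(1)[OF assms(1,3), of "-1"] unfolding subspace_mult_iff
  by (metis (no_types) diff_conv_add_uminus mult_minus1)

section \<open>Linear extensions\<close>

lemma pm_scale_single [simp]: "pm_scale c (Poly_Mapping.single a b) = Poly_Mapping.single a (c * b)"
  by (rule poly_mapping_eqI) (simp add: lookup_single when_def)

lemma pm_scale_conv_mult:
  fixes f :: "'a::monoid_add \<Rightarrow>\<^sub>0 'k::field"
  shows "pm_scale c f = Poly_Mapping.single 0 c * f"
  unfolding pm_scale_def by (rule mult_map_scale_conv_mult)

lemma pm_scale_mult:
  fixes u v :: "'a::comm_monoid_add \<Rightarrow>\<^sub>0 'k::field"
  shows "pm_scale (c * d) (u * v) = pm_scale c u * pm_scale d v"
proof -
  have "pm_scale (c * d) (u * v) = (Poly_Mapping.single 0 c * Poly_Mapping.single 0 d) * (u * v)"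
    by (simp add: pm_scale_conv_mult mult_single)
  then show ?thesis by (simp add: pm_scale_conv_mult ac_simps)
qed

lemma poly_mapping_sum_single: "(\<Sum>a\<in>keys f. Poly_Mapping.single a (lookup f a)) = f"
  by (rule poly_mapping_eqI) (auto simp: lookup_sum lookup_single when_def in_keys_iff)

text \<open>Both \<open>push\<close> and \<open>lin_subst A\<close> extend linearly a map given on a
  basis. Additivity, homogeneity and multiplicativity are proved once, for this common form.\<close>

definition lin_ext :: "('a \<Rightarrow> 'b \<Rightarrow>\<^sub>0 'k) \<Rightarrow> ('a \<Rightarrow>\<^sub>0 'k::field) \<Rightarrow> 'b \<Rightarrow>\<^sub>0 'k"
  where "lin_ext \<mu> f = (\<Sum>a\<in>keys f. pm_scale (lookup f a) (\<mu> a))"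

lemma lin_ext_superset:
  assumes "finite B" "keys f \<subseteq> B"
  shows "lin_ext \<mu> f = (\<Sum>a\<in>B. pm_scale (lookup f a) (\<mu> a))"
  unfolding lin_ext_def using assms by (intro sum.mono_neutral_left) (auto simp: in_keys_iff)

lemma lin_ext_add: "lin_ext \<mu> (f + g) = lin_ext \<mu> f + lin_ext \<mu> g"
proof -
  let ?B = "keys f \<union> keys g"
  have "lin_ext \<mu> h = (\<Sum>a\<in>?B. pm_scale (lookup h a) (\<mu> a))" if "keys h \<subseteq> ?B" for h
    using that by (intro lin_ext_superset) auto
  then show ?thesis
    using keys_add[of f g] by (simp add: lookup_add pm.scale_left_distrib sum.distrib)
qed

lemma lin_ext_zero [simp]: "lin_ext \<mu> 0 = 0"
  by (simp add: lin_ext_def)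

lemma lin_ext_single [simp]: "lin_ext \<mu> (Poly_Mapping.single a c) = pm_scale c (\<mu> a)"
  by (simp add: lin_ext_def)

lemma lin_ext_scale: "lin_ext \<mu> (pm_scale c f) = pm_scale c (lin_ext \<mu> f)"
proof -
  have "lin_ext \<mu> (pm_scale c f) = (\<Sum>a\<in>keys f. pm_scale (lookup (pm_scale c f) a) (\<mu> a))"
    by (rule lin_ext_superset) (auto simp: in_keys_iff)
  then show ?thesis by (simp add: lin_ext_def pm.scale_sum_right)
qed

lemma lin_ext_sum: "lin_ext \<mu> (\<Sum>x\<in>A. f x) = (\<Sum>x\<in>A. lin_ext \<mu> (f x))"
  by (induction A rule: infinite_finite_induct) (auto simp: lin_ext_add)

text \<open>Expanding both factors in basis elements makes the two sides agree term by term. This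
  yields the multiplicativity of \<open>to_laurent\<close> and of
  \<open>lin_subst A\<close>.\<close>

lemma lin_ext_mult:
  fixes \<mu> :: "'a::monoid_add \<Rightarrow> 'b::comm_monoid_add \<Rightarrow>\<^sub>0 'k::field"
  assumes "\<And>a b. \<mu> (a + b) = \<mu> a * \<mu> b"
  shows "lin_ext \<mu> (f * g) = lin_ext \<mu> f * lin_ext \<mu> g"
proof -
  have "f * g = (\<Sum>a\<in>keys f. \<Sum>b\<in>keys g. Poly_Mapping.single (a + b) (lookup f a * lookup g b))"
    by (simp add: poly_mapping_sum_single flip: sum_product mult_single)
  then have "lin_ext \<mu> (f * g) = (\<Sum>a\<in>keys f. \<Sum>b\<in>keys g. pm_scale (lookup f a * lookup g b) (\<mu> a * \<mu> b))"
    by (simp add: lin_ext_sum assms)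
  also have "\<dots> = (\<Sum>a\<in>keys f. \<Sum>b\<in>keys g. pm_scale (lookup f a) (\<mu> a) * pm_scale (lookup g b) (\<mu> b))"
    by (simp add: pm_scale_mult)
  finally show ?thesis by (simp add: lin_ext_def sum_product)
qed

lemma push_conv_lin_ext: "push \<phi> = lin_ext (\<lambda>a. Poly_Mapping.single (\<phi> a) 1)"
  by (simp add: fun_eq_iff push_def lin_ext_def)

section \<open>The grading\<close>

lemma mdeg_add: "mdeg (a + b) = mdeg a + mdeg b"
  by (simp add: mdeg_def lookup_add sum.distrib)

lemma mdeg_single [simp]: "mdeg (Poly_Mapping.single i c) = c"
  by (simp add: mdeg_def lookup_single when_def)

lemma mdeg_zero [simp]: "mdeg 0 = 0"
  by (simp add: mdeg_def)

lemma hom_polys_iff: "f \<in> hom_polys m \<longleftrightarrow> (\<forall>a. lookup f a \<noteq> 0 \<longrightarrow> mdeg a = m)"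
  by (auto simp: hom_polys_def in_keys_iff)

lemma hom_polys_mult:
  assumes "f \<in> hom_polys a" "g \<in> hom_polys b"
  shows "f * g \<in> hom_polys (a + b)"
  using assms keys_mult[of f g] by (auto simp: hom_polys_def mdeg_add)

lemma hom_polys_one: "1 \<in> hom_polys 0"
  by (simp add: hom_polys_def)

lemma hom_polys_power:
  assumes "f \<in> hom_polys a"
  shows "f ^ k \<in> hom_polys (k * a)"
  using assms by (induction k) (auto intro: hom_polys_mult hom_polys_one)

lemma hom_polys_prod:
  assumes "\<And>i. i \<in> A \<Longrightarrow> f i \<in> hom_polys (d i)"
  shows "(\<Prod>i\<in>A. f i) \<in> hom_polys (\<Sum>i\<in>A. d i)"
  using assms by (induction A rule: infinite_finite_induct) (auto intro: hom_polys_mult hom_polys_one)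

lemma subspace_hom_polys: "pm.subspace (hom_polys m)"
  by (auto simp: pm.subspace_def hom_polys_iff lookup_add) (metis add.right_neutral)

lemma var_in_hom_polys: "var i \<in> hom_polys 1"
  by (simp add: var_def hom_polys_def)

lemma var_power: "var i ^ k = Poly_Mapping.single (Poly_Mapping.single i k) 1"
  by (induction k) (auto simp: var_def mult_single simp flip: single_add)

lemma lookup_hom_part: "lookup (hom_part m f) a = (if mdeg a = m then lookup f a else 0)"
  by (auto simp: hom_part_def lookup_sum lookup_single when_def in_keys_iff)

lemma hom_part_add: "hom_part m (f + g) = hom_part m f + hom_part m g"
  by (rule poly_mapping_eqI) (simp add: lookup_hom_part lookup_add)

lemma hom_part_diff: "hom_part m (f - g) = hom_part m f - hom_part m g"
  by (rule poly_mapping_eqI) (simp add: lookup_hom_part lookup_minus)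

lemma hom_part_in_hom_polys: "hom_part m f \<in> hom_polys m"
  by (simp add: hom_polys_iff lookup_hom_part)

lemma hom_part_hom_polys:
  "f \<in> hom_polys d \<Longrightarrow> hom_part m f = (if m = d then f else 0)"
  by (rule poly_mapping_eqI) (auto simp: hom_polys_iff lookup_hom_part)

lemma hom_part_eq_0_iff: "hom_part m f = 0 \<longleftrightarrow> (\<forall>a\<in>keys f. mdeg a \<noteq> m)"
  by (auto simp: poly_mapping_eq_iff fun_eq_iff lookup_hom_part in_keys_iff)

text \<open>A form of degree \<open>a\<close> shifts degrees by exactly \<open>a\<close>. Once the
  part of degree \<open>m - a\<close> is removed from \<open>g\<close>, the product has no monomial
  of degree \<open>m\<close> left; for \<open>a > m\<close> it has none to begin with.\<close>

lemma hom_part_mult_hom_polys: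
  assumes "f \<in> hom_polys a"
  shows "hom_part m (f * g) = (if a \<le> m then f * hom_part (m - a) g else 0)"
proof (cases "a \<le> m")
  case True
  have "hom_part m (f * (g - hom_part (m - a) g)) = 0"
    unfolding hom_part_eq_0_iff
  proof
    fix c assume "c \<in> keys (f * (g - hom_part (m - a) g))"
    then obtain u v where "c = u + v" "u \<in> keys f" "v \<in> keys (g - hom_part (m - a) g)"
      using keys_mult by blast
    then show "mdeg c \<noteq> m"
      using assms by (auto simp: hom_polys_def mdeg_add in_keys_iff lookup_minus lookup_hom_part split: if_splits)
  qed
  moreover have "hom_part m (f * hom_part (m - a) g) = f * hom_part (m - a) g"
    using hom_part_hom_polys[OF hom_polys_mult[OF assms hom_part_in_hom_polys], of m "m - a" g] True
    by simp
  ultimately show ?thesis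
    using True by (simp add: right_diff_distrib hom_part_diff)
next
  case False
  then have "hom_part m (f * g) = 0"
    unfolding hom_part_eq_0_iff using assms keys_mult[of f g] by (fastforce simp: hom_polys_def mdeg_add)
  with False show ?thesis by simp
qed

lemma sum_hom_parts:
  assumes "\<And>a. a \<in> keys f \<Longrightarrow> mdeg a \<le> M"
  shows "(\<Sum>m\<le>M. hom_part m f) = f"
  by (rule poly_mapping_eqI) (use assms in \<open>auto simp: lookup_sum lookup_hom_part in_keys_iff\<close>)

text \<open>A polynomial is a finite sum of homogeneous parts, so some part of \<open>f\<close> is
  outside the ideal. The last such part serves as a leading term modulo \<open>p\<close>.\<close>

lemma exists_top_hom_part_notin:
  assumes "module.subspace (*) p" "f \<notin> p"
  obtains m where "hom_part m f \<notin> p" "\<And>m'. m < m' \<Longrightarrow> hom_part m' f \<in> p"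
proof -
  define M where "M = Max (insert 0 (mdeg ` keys f))"
  have le: "mdeg a \<le> M" if "a \<in> keys f" for a
    using that by (auto simp: M_def)
  let ?A = "{m. hom_part m f \<notin> p}"
  have "?A \<noteq> {}"
    using ideal_sum[OF assms(1), of "{..M}" "\<lambda>m. hom_part m f"] sum_hom_parts[of f M] le assms(2) by auto
  moreover have "?A \<subseteq> {..M}"
  proof
    fix m assume "m \<in> ?A"
    then have "hom_part m f \<noteq> 0" using assms(1) by (auto simp: subspace_mult_iff)
    then show "m \<in> {..M}" using le by (auto simp: hom_part_eq_0_iff)
  qed
  then have fin: "finite ?A" by (rule finite_subset) simp
  ultimately have top: "Max ?A \<in> ?A" by (intro Max_in) auto
  show ?thesis
  proof (rule that)
    show "hom_part (Max ?A) f \<notin> p" using top by blast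
    show "hom_part m f \<in> p" if "Max ?A < m" for m
      using Max_ge[OF fin, of m] that by (meson leD mem_Collect_eq)
  qed
qed

section \<open>Homogeneous primes and degenerate reduced schemes\<close>

text \<open>Primality of a homogeneous ideal can be tested on forms: if \<open>f\<close> and
  \<open>g\<close> were outside \<open>p\<close>, their leading parts modulo \<open>p\<close> would
  have as product the part of \<open>f * g\<close> of degree \<open>a + b\<close>, up to elements of
  \<open>p\<close>.\<close>

lemma homogeneous_prime_if:
  fixes p :: "('n::finite, 'k::field) mpoly set"
  assumes p: "homogeneous_ideal p"
    and hom: "\<And>f g a b. f \<in> hom_polys a \<Longrightarrow> g \<in> hom_polys b \<Longrightarrow> f * g \<in> p \<Longrightarrow> f \<in> p \<or> g \<in> p"
    and "f * g \<in> p"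
  shows "f \<in> p \<or> g \<in> p"
proof (rule ccontr)
  assume "\<not> (f \<in> p \<or> g \<in> p)"
  then have f: "f \<notin> p" and g: "g \<notin> p" by auto
  have id: "module.subspace (*) p" using p by (simp add: homogeneous_ideal_def)
  obtain a where a: "hom_part a f \<notin> p" "\<And>m. a < m \<Longrightarrow> hom_part m f \<in> p"
    using exists_top_hom_part_notin[OF id f] by blast
  obtain b where b: "hom_part b g \<notin> p" "\<And>m. b < m \<Longrightarrow> hom_part m g \<in> p"
    using exists_top_hom_part_notin[OF id g] by blast
  \<comment> \<open>The bound makes \<open>f\<close> the sum of its parts up to \<open>M\<close> and
    puts \<open>a\<close> in the range of summation, so that the summand \<open>m = a\<close> can be
    split off.\<close>
  obtain M where M: "\<And>c. c \<in> keys f \<Longrightarrow> mdeg c \<le> M" "a + b \<le> M"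
  proof
    show "mdeg c \<le> a + b + Max (insert 0 (mdeg ` keys f))" if "c \<in> keys f" for c
      using that by (simp add: trans_le_add2)
  qed simp
  have "hom_part (a + b) (f * g) = (\<Sum>m\<le>M. hom_part (a + b) (hom_part m f * g))"
  proof -
    have "f * g = (\<Sum>m\<le>M. hom_part m f * g)"
      using sum_hom_parts[of f M] M(1) by (metis sum_distrib_right)
    moreover have "hom_part (a + b) (\<Sum>m\<in>A. h m) = (\<Sum>m\<in>A. hom_part (a + b) (h m))"
      for A :: "nat set" and h :: "nat \<Rightarrow> ('n, 'k) mpoly"
      by (induction A rule: infinite_finite_induct)
        (auto simp: hom_part_add hom_part_eq_0_iff)
    ultimately show ?thesis by simp
  qed
  also have "\<dots> = (\<Sum>m\<le>M. if m \<le> a + b then hom_part m f * hom_part (a + b - m) g else 0)"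
    by (simp add: hom_part_mult_hom_polys[OF hom_part_in_hom_polys])
  also have "\<dots> = hom_part a f * hom_part b g
      + (\<Sum>m\<in>{..M} - {a}. if m \<le> a + b then hom_part m f * hom_part (a + b - m) g else 0)"
    using M(2) by (subst sum.remove[of _ a]) auto
  finally have eq: "hom_part a f * hom_part b g = hom_part (a + b) (f * g)
      - (\<Sum>m\<in>{..M} - {a}. if m \<le> a + b then hom_part m f * hom_part (a + b - m) g else 0)"
    by simp
  have "(\<Sum>m\<in>{..M} - {a}. if m \<le> a + b then hom_part m f * hom_part (a + b - m) g else 0) \<in> p"
  proof (rule ideal_sum[OF id])
    fix m assume "m \<in> {..M} - {a}"
    \<comment> \<open>Either the part of \<open>f\<close> lies beyond \<open>a\<close>, or the
      complementary degree \<open>a + b - m\<close> exceeds \<open>b\<close>. In both cases one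
      factor is in \<open>p\<close>.\<close>
    then consider "a < m" | "m < a" by fastforce
    then show "(if m \<le> a + b then hom_part m f * hom_part (a + b - m) g else 0) \<in> p"
      using a(2) b(2) ideal_mult[OF id] id by cases (auto simp: subspace_mult_iff)
  qed
  moreover have "hom_part (a + b) (f * g) \<in> p"
    using p assms(3) by (simp add: homogeneous_ideal_def)
  ultimately have "hom_part a f * hom_part b g \<in> p"
    unfolding eq by (intro ideal_diff[OF id])
  then show False
    using hom[OF hom_part_in_hom_polys hom_part_in_hom_polys] a(1) b(1) by blast
qed

text \<open>Zorn's lemma gives an ideal maximal among the homogeneous ideals that contain
  \<open>I\<close> and no power of \<open>h\<close>. It is prime, as in the ungraded proof that a
  radical is an intersection of primes.\<close>

lemma exists_homogeneous_prime_avoiding_powers: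
  fixes I :: "('n::finite, 'k::field) mpoly set"
  assumes I: "homogeneous_ideal I" and h: "\<And>n. h ^ n \<notin> I"
  obtains p where "homogeneous_ideal p" "I \<subseteq> p" "h \<notin> p" "p \<noteq> UNIV"
    "\<And>f g. f * g \<in> p \<Longrightarrow> f \<in> p \<or> g \<in> p"
proof -
  define \<A> where "\<A> = {J. homogeneous_ideal J \<and> I \<subseteq> J \<and> (\<forall>n. h ^ n \<notin> J)}"
  have "\<exists>p\<in>\<A>. \<forall>X\<in>\<A>. p \<subseteq> X \<longrightarrow> X = p"
  proof (rule subset_Zorn_nonempty)
    show "\<A> \<noteq> {}" using I h by (auto simp: \<A>_def)
    fix \<C> assume ne: "\<C> \<noteq> {}" and ch: "subset.chain \<A> \<C>"
    have sub: "\<C> \<subseteq> \<A>" using ch by (simp add: subset.chain_def)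
    have ideals: "module.subspace (*) X" if "X \<in> \<C>" for X
      using that sub by (auto simp: \<A>_def homogeneous_ideal_def)
    have "module.subspace (*) (\<Union>\<C>)"
      unfolding subspace_mult_iff
    proof (intro conjI ballI allI)
      show "0 \<in> \<Union>\<C>"
        using ne ideals by (auto simp: subspace_mult_iff)
      fix x assume x: "x \<in> \<Union>\<C>"
      then show "c * x \<in> \<Union>\<C>" for c
        using ideal_mult(1)[OF ideals] by blast
      fix y assume "y \<in> \<Union>\<C>"
      then obtain X Y where XY: "X \<in> \<C>" "x \<in> X" "Y \<in> \<C>" "y \<in> Y" using x by blast
      then have "X \<subseteq> Y \<or> Y \<subseteq> X" using ch by (auto simp: subset.chain_def)
      then obtain Z where "Z \<in> \<C>" "x \<in> Z" "y \<in> Z" using XY by blast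
      then show "x + y \<in> \<Union>\<C>"
        using ideals[of Z] by (auto simp: subspace_mult_iff)
    qed
    moreover have "hom_part m f \<in> \<Union>\<C>" if "f \<in> \<Union>\<C>" for f m
      using that sub unfolding \<A>_def homogeneous_ideal_def by blast
    moreover have "I \<subseteq> \<Union>\<C>" "h ^ n \<notin> \<Union>\<C>" for n
      using ne sub unfolding \<A>_def by blast+
    ultimately show "\<Union>\<C> \<in> \<A>"
      by (simp add: \<A>_def homogeneous_ideal_def)
  qed
  then obtain p where "p \<in> \<A>" and max: "\<And>X. X \<in> \<A> \<Longrightarrow> p \<subseteq> X \<Longrightarrow> X = p" by blast
  then have p: "homogeneous_ideal p" "I \<subseteq> p" "\<And>n. h ^ n \<notin> p" by (auto simp: \<A>_def)
  have id: "module.subspace (*) p" using p by (simp add: homogeneous_ideal_def)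
  \<comment> \<open>Adjoining \<open>f\<close> to \<open>p\<close> gives a properly larger ideal
    \<open>J\<close>, which is homogeneous because \<open>f\<close> is a form. By maximality
    \<open>J\<close> contains a power of \<open>h\<close>.\<close>
  have power: "\<exists>n. \<exists>j\<in>p. \<exists>s. h ^ n = j + f * s" if f: "f \<in> hom_polys a" "f \<notin> p" for f a
  proof (rule ccontr)
    assume neg: "\<not> ?thesis"
    define J where "J = {j + f * s | j s. j \<in> p}"
    have "module.subspace (*) J"
      unfolding subspace_mult_iff
    proof (intro conjI ballI allI)
      have "0 + f * 0 \<in> J" using id unfolding J_def subspace_mult_iff by blast
      then show "0 \<in> J" by simp
      fix x assume "x \<in> J"
      then obtain j s where x: "x = j + f * s" "j \<in> p" by (auto simp: J_def)
      have "c * x = c * j + f * (c * s)" for c by (simp add: x algebra_simps)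
      then show "c * x \<in> J" for c using ideal_mult(1)[OF id x(2)] by (auto simp: J_def)
      fix y assume "y \<in> J"
      then obtain j' s' where y: "y = j' + f * s'" "j' \<in> p" by (auto simp: J_def)
      have "x + y = (j + j') + f * (s + s')" by (simp add: x y algebra_simps)
      moreover have "j + j' \<in> p" using id x y by (simp add: subspace_mult_iff)
      ultimately show "x + y \<in> J" unfolding J_def by blast
    qed
    moreover have "hom_part m x \<in> J" if "x \<in> J" for x m
    proof -
      obtain j s where x: "x = j + f * s" "j \<in> p" using \<open>x \<in> J\<close> by (auto simp: J_def)
      have "hom_part m x = hom_part m j + f * (if a \<le> m then hom_part (m - a) s else 0)"
        by (simp add: x hom_part_add hom_part_mult_hom_polys[OF f(1)])
      moreover have "hom_part m j \<in> p" using p(1) x(2) by (simp add: homogeneous_ideal_def)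
      ultimately show ?thesis unfolding J_def by blast
    qed
    ultimately have "homogeneous_ideal J" by (simp add: homogeneous_ideal_def)
    moreover have pJ: "p \<subseteq> J"
    proof
      fix j assume "j \<in> p"
      then have "j + f * 0 \<in> J" unfolding J_def by blast
      then show "j \<in> J" by simp
    qed
    moreover have "h ^ n \<notin> J" for n using neg by (auto simp: J_def)
    ultimately have "J \<in> \<A>" using p(2) by (auto simp: \<A>_def)
    then have "J = p" using max pJ by blast
    moreover have "0 + f * 1 \<in> J" using id unfolding J_def subspace_mult_iff by blast
    ultimately show False using f(2) by simp
  qed
  have prime: "f \<in> p \<or> g \<in> p" if hom: "f \<in> hom_polys a" "g \<in> hom_polys b" and "f * g \<in> p" for f g a b
  proof (rule ccontr)
    assume "\<not> (f \<in> p \<or> g \<in> p)"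
    then obtain n j s n' j' s' where n: "h ^ n = j + f * s" "j \<in> p" "h ^ n' = j' + g * s'" "j' \<in> p"
      using power hom by meson
    \<comment> \<open>Multiplying the two representations leaves, apart from multiples of
      \<open>j\<close> and \<open>j'\<close>, only a multiple of \<open>f * g\<close>.\<close>
    have "h ^ (n + n') = j * (j' + g * s') + f * s * j' + f * g * (s * s')"
      by (simp add: power_add n algebra_simps)
    also have "\<dots> \<in> p"
      using ideal_mult[OF id] n(2,4) \<open>f * g \<in> p\<close> id by (simp add: subspace_mult_iff)
    finally show False using p(3) by blast
  qed
  show ?thesis
  proof (rule that)
    show "h \<notin> p" "p \<noteq> UNIV" using p(3)[of 1] by auto
    show "f \<in> p \<or> g \<in> p" if "f * g \<in> p" for f g
      by (rule homogeneous_prime_if[OF p(1) _ that]) (use prime in blast)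
  qed (use p in auto)
qed

text \<open>By the pigeonhole principle a monomial of degree \<open>CARD('n) * K\<close> has an
  exponent at least \<open>K\<close>, hence is divisible by some \<open>var i ^ k i\<close>. So
  every form of this degree multiplies \<open>f\<close> into \<open>I\<close>.\<close>

lemma saturatedD_var_powers:
  fixes I :: "('n::finite, 'k::field) mpoly set"
  assumes I: "homogeneous_ideal I" "saturated I" and f: "\<And>i. \<exists>k. var i ^ k * f \<in> I"
  shows "f \<in> I"
proof -
  have id: "module.subspace (*) I" using I by (simp add: homogeneous_ideal_def)
  obtain k where k: "\<And>i. var i ^ k i * f \<in> I" using f by metis
  define K where "K = Max (range k)"
  have kK: "k i \<le> K" for i by (simp add: K_def)
  have "g * f \<in> I" if g: "g \<in> hom_polys (CARD('n) * K)" for g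
  proof -
    have "Poly_Mapping.single a c * f \<in> I" if "mdeg a = CARD('n) * K" for a c
    proof -
      obtain i where i: "K \<le> lookup a i"
      proof (rule ccontr)
        assume neg: "\<not> thesis"
        then have "lookup a i < K" for i using that leI by blast
        then have "(\<Sum>i\<in>UNIV. lookup a i) < (\<Sum>i\<in>(UNIV::'n set). K)"
          by (intro sum_strict_mono) auto
        then show False using \<open>mdeg a = _\<close> by (simp add: mdeg_def)
      qed
      then have le: "k i \<le> lookup a i" using kK le_trans by blast
      have "a = (a - Poly_Mapping.single i (k i)) + Poly_Mapping.single i (k i)"
        using le by (intro poly_mapping_eqI) (auto simp: lookup_add lookup_minus lookup_single when_def)
      then have "Poly_Mapping.single a c
          = Poly_Mapping.single (a - Poly_Mapping.single i (k i)) c * var i ^ k i"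
        by (simp add: var_power mult_single)
      then show ?thesis using ideal_mult(1)[OF id k] by (metis mult.assoc)
    qed
    then have "(\<Sum>a\<in>keys g. Poly_Mapping.single a (lookup g a) * f) \<in> I"
      using g by (intro ideal_sum[OF id]) (auto simp: hom_polys_def)
    then show ?thesis by (simp add: poly_mapping_sum_single flip: sum_distrib_right)
  qed
  then show ?thesis using I(2) unfolding saturated_def by blast
qed

section \<open>Polynomials inside Laurent polynomials, and sections over the standard charts\<close>

lemma lookup_map_int [simp]: "lookup (Poly_Mapping.map int a) i = int (lookup a i)"
  by (simp add: Poly_Mapping.map.rep_eq when_def)

lemma to_laurent_mult: "to_laurent (f * g) = to_laurent f * to_laurent g"
proof -
  have "Poly_Mapping.map int (a + b) = Poly_Mapping.map int a + Poly_Mapping.map int b"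
    for a b :: "'a \<Rightarrow>\<^sub>0 nat"
    by (rule poly_mapping_eqI) (simp add: lookup_add)
  then show ?thesis
    unfolding to_laurent_def push_conv_lin_ext
    by (intro lin_ext_mult) (simp add: mult_single)
qed

lemma to_laurent_single:
  "to_laurent (Poly_Mapping.single a c) = Poly_Mapping.single (Poly_Mapping.map int a) c"
  by (simp add: to_laurent_def push_conv_lin_ext)

lemma to_laurent_one [simp]: "to_laurent 1 = 1"
  by (simp add: to_laurent_def push_def flip: single_one)
    (simp add: poly_mapping_eq_iff fun_eq_iff lookup_one lookup_single)

lemma to_laurent_power: "to_laurent (f ^ n) = to_laurent f ^ n"
  by (induction n) (auto simp: to_laurent_mult)

lemma to_laurent_var_power:
  "to_laurent (var i ^ k) = Poly_Mapping.single (Poly_Mapping.single i (int k)) 1"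
  by (simp add: var_power to_laurent_single)

text \<open>The inclusion of exponents is injective, so no coefficients are merged. Hence identities
  between images of polynomials descend to the polynomials.\<close>

lemma lookup_to_laurent [simp]: "lookup (to_laurent f) (Poly_Mapping.map int a) = lookup f a"
proof -
  have inj: "Poly_Mapping.map int b = Poly_Mapping.map int a \<longleftrightarrow> b = a" for b
    by (auto simp: poly_mapping_eq_iff[of "Poly_Mapping.map int b"] poly_mapping_eq_iff[of b] fun_eq_iff)
  show ?thesis
    by (auto simp: to_laurent_def push_def lookup_sum lookup_single inj when_def in_keys_iff)
qed

lemma to_laurent_eq_iff [simp]: "to_laurent f = to_laurent g \<longleftrightarrow> f = g"
  by (metis lookup_to_laurent poly_mapping_eqI)

lemma keys_to_laurent: "keys (to_laurent f) \<subseteq> Poly_Mapping.map int ` keys f"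
  by (auto simp: to_laurent_def push_def in_keys_iff lookup_sum lookup_single when_def
      elim!: sum.not_neutral_contains_not_neutral split: if_splits)

lemma mdeg_map_int: "mdeg (Poly_Mapping.map int a) = int (mdeg a)"
  by (simp add: mdeg_def)

lemma to_laurent_in_loc_part:
  fixes f :: "('n::finite, 'k::field) mpoly"
  assumes "f \<in> hom_polys m" "keys b \<subseteq> T"
  shows "Poly_Mapping.single b 1 * to_laurent f \<in> loc_part T (mdeg b + int m)"
proof -
  have "mdeg c = mdeg b + int m \<and> (\<forall>i. i \<notin> T \<longrightarrow> 0 \<le> lookup c i)"
    if c: "c \<in> keys (Poly_Mapping.single b 1 * to_laurent f)" for c
  proof -
    obtain u v where "c = u + v" "u \<in> keys (Poly_Mapping.single b (1::'k))" "v \<in> keys (to_laurent f)"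
      using subsetD[OF keys_mult c] by blast
    then obtain a where "c = b + Poly_Mapping.map int a" "a \<in> keys f"
      using keys_to_laurent[of f] by auto
    moreover have "0 \<le> lookup b i" if "i \<notin> T" for i
      using assms(2) that by (metis in_keys_iff order_refl subsetD)
    ultimately show ?thesis
      using assms(1) by (auto simp: mdeg_add mdeg_map_int hom_polys_def lookup_add)
  qed
  then show ?thesis by (simp add: loc_part_def)
qed

text \<open>Denominators are cleared: the assumption says that \<open>f\<close> is an integer power
  of \<open>x_i\<close> times some \<open>g\<close> in \<open>I\<close>, and a further power of
  \<open>x_i\<close> turns this into an identity of polynomials.\<close>

lemma loc_ideal_singletonD:
  assumes id: "module.subspace (*) I" and b: "keys b \<subseteq> {i}"
    and "Poly_Mapping.single b 1 * to_laurent f \<in> loc_ideal {i} I"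
  obtains k where "var i ^ k * f \<in> I"
proof -
  obtain a g where eq: "Poly_Mapping.single b 1 * to_laurent f = Poly_Mapping.single a 1 * to_laurent g"
    and a: "keys a \<subseteq> {i}" and g: "g \<in> I"
    using assms(3) by (auto simp: loc_ideal_def)
  define c where "c = lookup (a - b) i"
  have "lookup (a - b) j = 0" if "j \<noteq> i" for j
    using a b that by (metis in_keys_iff lookup_minus diff_self singletonD subsetD)
  then have c: "a - b = Poly_Mapping.single i c"
    by (intro poly_mapping_eqI) (auto simp: c_def lookup_single when_def)
  have "to_laurent f = Poly_Mapping.single (- b) 1 * (Poly_Mapping.single b 1 * to_laurent f)"
    by (simp add: mult_single flip: mult.assoc)
  also have "\<dots> = Poly_Mapping.single (a - b) 1 * to_laurent g"
    by (simp add: eq mult_single flip: mult.assoc)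
  finally have f: "to_laurent f = Poly_Mapping.single (Poly_Mapping.single i c) 1 * to_laurent g"
    by (simp add: c)
  \<comment> \<open>Since \<open>nat (- c) + c = nat c\<close>, this multiplication leaves only
    natural exponents on both sides, whatever the sign of \<open>c\<close>.\<close>
  have "to_laurent (var i ^ nat (- c) * f) = to_laurent (var i ^ nat c * g)"
    by (simp add: to_laurent_mult to_laurent_var_power f mult_single flip: mult.assoc single_add)
  then have "var i ^ nat (- c) * f = var i ^ nat c * g" by simp
  then show ?thesis using that ideal_mult(1)[OF id g] by metis
qed

text \<open>On the chart of \<open>x_i\<close> the function \<open>l / x_i\<close> vanishes at all
  points, so it is nilpotent and, by reducedness, zero. Thus a power of \<open>x_i\<close>
  multiplies \<open>l\<close> into \<open>I\<close> for each \<open>i\<close>.\<close>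

lemma reduced_degenerate_in_hyperplane:
  fixes I :: "('n::finite, 'k::field) mpoly set"
  assumes I: "closed_subscheme I" and red: "reduced_scheme I" and deg: "degenerate I"
  obtains l where "hyperplane_form l" "l \<in> I"
proof -
  have hI: "homogeneous_ideal I" and sat: "saturated I" using I by (auto simp: closed_subscheme_def)
  have id: "module.subspace (*) I" using hI by (simp add: homogeneous_ideal_def)
  obtain l where l: "hyperplane_form l" "\<And>p. p \<in> proj_points I \<Longrightarrow> l \<in> p"
    using deg by (auto simp: degenerate_def)
  have "\<exists>k. var i ^ k * l \<in> I" for i
  proof -
    \<comment> \<open>A prime omitting \<open>l * var i\<close> omits both factors: omitting
      \<open>var i\<close> makes it a point of the projective scheme, and omitting \<open>l\<close>
      then contradicts degeneracy.\<close>
    obtain n where n: "(l * var i) ^ n \<in> I"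
    proof (rule ccontr)
      assume "\<not> thesis"
      then have "\<And>n. (l * var i) ^ n \<notin> I" using that by blast
      then obtain p where p: "homogeneous_ideal p" "I \<subseteq> p" "l * var i \<notin> p" "p \<noteq> UNIV"
        "\<And>f g. f * g \<in> p \<Longrightarrow> f \<in> p \<or> g \<in> p"
        using exists_homogeneous_prime_avoiding_powers[OF hI, of "l * var i"] by metis
      have "l \<notin> p" "var i \<notin> p"
        using p(1,3) ideal_mult[of p] by (auto simp: homogeneous_ideal_def)
      then show False using l(2)[of p] p by (auto simp: proj_points_def)
    qed
    define b where "b c = Poly_Mapping.single i (c::int)" for c
    have bn: "Poly_Mapping.single (b c) (1::'k) ^ n = Poly_Mapping.single (b (int n * c)) 1" for c n
      by (induction n) (auto simp: b_def mult_single algebra_simps simp flip: single_add)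
    have keys_b: "keys (b c) \<subseteq> {i}" for c by (simp add: b_def)
    define s where "s = Poly_Mapping.single (b (-1)) 1 * to_laurent l"
    have "s \<in> loc_part {i} 0"
      using to_laurent_in_loc_part[of l 1 "b (-1)" "{i}"] l(1) keys_b
      by (simp add: s_def hyperplane_form_def b_def)
    \<comment> \<open>The quotient \<open>l / x_i\<close> is rewritten with numerator
      \<open>l * x_i\<close> and denominator the square of \<open>x_i\<close>, so that its power
      involves the element already known to be in \<open>I\<close>.\<close>
    moreover have "s ^ n = Poly_Mapping.single (b (- 2 * int n)) 1 * to_laurent ((l * var i) ^ n)"
    proof -
      have "to_laurent (var i) = Poly_Mapping.single (b 1) (1::'k)"
        using to_laurent_var_power[of i 1] by (simp add: b_def)
      then have "s = Poly_Mapping.single (b (- 2)) 1 * to_laurent (l * var i)"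
        by (simp add: s_def to_laurent_mult b_def mult_single ac_simps flip: single_add)
      then show ?thesis
        by (simp add: power_mult_distrib bn mult.commute flip: to_laurent_power)
    qed
    then have "s ^ n \<in> loc_ideal {i} I"
      using n keys_b by (auto simp: loc_ideal_def)
    ultimately have "s \<in> loc_ideal {i} I" using red by (auto simp: reduced_scheme_def)
    then show ?thesis
      using loc_ideal_singletonD[OF id keys_b] unfolding s_def by metis
  qed
  then have "l \<in> I" by (rule saturatedD_var_powers[OF hI sat])
  then show ?thesis using that l(1) by blast
qed

text \<open>At a point \<open>p\<close> some \<open>x_i\<close> is invertible. If all sections were
  null, so would be \<open>x_i ^ m\<close>, and a power of \<open>x_i\<close> would lie in
  \<open>p\<close>. This makes the degree of the exterior power positive.\<close>

lemma global_sections_nonzero: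
  fixes I :: "('n::finite, 'k::field) mpoly set"
  assumes I: "homogeneous_ideal I" and X: "proj_points I \<noteq> {}"
    and d: "has_quot_dim tuple_scale (twist_sections I m) (twist_null I m) d"
  shows "d > 0"
proof (rule ccontr)
  assume "\<not> d > 0"
  then have null: "twist_sections I m \<subseteq> twist_null I m"
    using d by (auto simp: has_quot_dim_def)
  have id: "module.subspace (*) I" using I by (simp add: homogeneous_ideal_def)
  obtain p i where p: "homogeneous_ideal p" "I \<subseteq> p" "p \<noteq> UNIV" "var i \<notin> p"
    "\<And>f g. f * g \<in> p \<Longrightarrow> f \<in> p \<or> g \<in> p"
    using X by (auto simp: proj_points_def)
  let ?s = "(\<chi> j. to_laurent (var i ^ m)) :: ('n, 'k) laurent ^ 'n"
  have hom: "(var i ^ m :: ('n, 'k) mpoly) \<in> hom_polys m"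
    using hom_polys_power[OF var_in_hom_polys, of i m] by simp
  have "(0 :: ('n, 'k) laurent) \<in> loc_ideal T I" for T
  proof -
    have "(0 :: ('n, 'k) laurent) = Poly_Mapping.single 0 1 * to_laurent 0"
      by (simp add: to_laurent_def push_def)
    moreover have "0 \<in> I" using id by (simp add: subspace_mult_iff)
    ultimately show ?thesis
      unfolding loc_ideal_def by (metis (mono_tags, lifting) CollectI empty_subsetI keys_zero)
  qed
  moreover have "to_laurent (var i ^ m :: ('n, 'k) mpoly) \<in> loc_part {j} (int m)" for j
    using to_laurent_in_loc_part[OF hom, of 0 "{j}"] by simp
  ultimately have "?s \<in> twist_sections I m" by (simp add: twist_sections_def)
  then have "Poly_Mapping.single 0 1 * to_laurent (var i ^ m :: ('n, 'k) mpoly) \<in> loc_ideal {i} I"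
    using null by (auto simp: twist_null_def)
  then obtain k where "var i ^ k * var i ^ m \<in> I"
    using loc_ideal_singletonD[OF id, of 0 i] by auto
  then have "var i ^ (k + m) \<in> p" using p(2) by (auto simp: power_add)
  then show False
  \<comment> \<open>Primality lowers the exponent one step at a time, down to exponent
    \<open>0\<close>, where \<open>p\<close> would be the whole ring.\<close>
  proof (induction "k + m" arbitrary: k m)
    case 0
    then have "x * 1 \<in> p" for x
      using ideal_mult(1) p(1) unfolding homogeneous_ideal_def by (metis power_0)
    then show ?case using p(3) by auto
  next
    case (Suc n)
    then have "var i * var i ^ n \<in> p" by (metis power_Suc)
    then show ?case using p(4,5) Suc(1)[of n 0] by auto
  qed
qed

section \<open>Linear changes of coordinates\<close>

lemma lin_subst_conv_lin_ext:
  "lin_subst A = lin_ext (\<lambda>a. \<Prod>i\<in>UNIV. (\<Sum>j\<in>UNIV. pm_scale (A $ i $ j) (var j)) ^ lookup a i)"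
  by (simp add: fun_eq_iff lin_subst_def lin_ext_def)

lemma lin_subst_add: "lin_subst A (f + g) = lin_subst A f + lin_subst A g"
  by (simp add: lin_subst_conv_lin_ext lin_ext_add)

lemma lin_subst_scale: "lin_subst A (pm_scale c f) = pm_scale c (lin_subst A f)"
  by (simp add: lin_subst_conv_lin_ext lin_ext_scale)

lemma lin_subst_sum: "lin_subst A (\<Sum>x\<in>X. f x) = (\<Sum>x\<in>X. lin_subst A (f x))"
  by (simp add: lin_subst_conv_lin_ext lin_ext_sum)

lemma lin_subst_mult: "lin_subst A (f * g) = lin_subst A f * lin_subst A g"
  unfolding lin_subst_conv_lin_ext
  by (rule lin_ext_mult) (simp add: lookup_add power_add prod.distrib)

lemma lin_subst_single:
  "lin_subst A (Poly_Mapping.single a 1) = (\<Prod>i\<in>UNIV. (\<Sum>j\<in>UNIV. pm_scale (A $ i $ j) (var j)) ^ lookup a i)"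
  by (simp add: lin_subst_conv_lin_ext)

lemma lin_subst_one [simp]: "lin_subst A 1 = 1"
  using lin_subst_single[of A 0] by simp

lemma lin_subst_power: "lin_subst A (f ^ n) = lin_subst A f ^ n"
  by (induction n) (auto simp: lin_subst_mult)

lemma lin_subst_prod: "lin_subst A (\<Prod>x\<in>X. f x) = (\<Prod>x\<in>X. lin_subst A (f x))"
  by (induction X rule: infinite_finite_induct) (auto simp: lin_subst_mult)

lemma lin_subst_var: "lin_subst A (var i) = (\<Sum>j\<in>UNIV. pm_scale (A $ i $ j) (var j))"
proof -
  have "x ^ lookup (Poly_Mapping.single i (1::nat)) k = (if k = i then x else 1)"
    for x :: "('a, 'b) mpoly" and k
    by (simp add: lookup_single when_def)
  then show ?thesis by (subst var_def) (simp add: lin_subst_single)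
qed

lemma lin_subst_expand:
  "lin_subst A f = (\<Sum>a\<in>keys f. pm_scale (lookup f a) (lin_subst A (Poly_Mapping.single a 1)))"
  by (simp add: lin_subst_def)

lemma lin_subst_in_hom_polys:
  assumes "f \<in> hom_polys m"
  shows "lin_subst A f \<in> hom_polys m"
proof -
  have lin: "(\<Sum>j\<in>UNIV. pm_scale (A $ i $ j) (var j)) \<in> hom_polys 1" for i
    by (intro pm.subspace_sum pm.subspace_scale subspace_hom_polys var_in_hom_polys)
  have "lin_subst A (Poly_Mapping.single a 1) \<in> hom_polys (mdeg a)" for a
    using hom_polys_prod[of UNIV, OF hom_polys_power[OF lin]]
    by (simp add: lin_subst_single mdeg_def)
  then show ?thesis
    using assms unfolding lin_subst_expand[of A f]
    by (intro pm.subspace_sum pm.subspace_scale subspace_hom_polys) (auto simp: hom_polys_def)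
qed

text \<open>Substituting \<open>B\<close> into the linear forms given by the rows of
  \<open>C\<close> multiplies those rows by \<open>B\<close> on the right, so the substitution
  performed first is the left factor.\<close>

lemma lin_subst_lin_subst: "lin_subst B (lin_subst C f) = lin_subst (C ** B) f"
proof -
  have "lin_subst B (\<Sum>j\<in>UNIV. pm_scale (C $ i $ j) (var j))
      = (\<Sum>k\<in>UNIV. pm_scale ((C ** B) $ i $ k) (var k))" for i
    by (simp add: lin_subst_sum lin_subst_scale lin_subst_var matrix_matrix_mult_def
        pm.scale_sum_right pm.scale_sum_left) (rule sum.swap)
  then have "lin_subst B (lin_subst C (Poly_Mapping.single a 1)) = lin_subst (C ** B) (Poly_Mapping.single a 1)" for a
    by (simp add: lin_subst_single lin_subst_prod lin_subst_power)
  then show ?thesis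
    by (subst (2) lin_subst_expand, subst lin_subst_expand) (simp add: lin_subst_sum lin_subst_scale)
qed

lemma single_conv_prod_var:
  "Poly_Mapping.single a 1 = (\<Prod>i\<in>UNIV. var i ^ lookup a i :: ('n::finite, 'k::field) mpoly)"
proof -
  have "(\<Prod>i\<in>X. var i ^ lookup a i :: ('n, 'k) mpoly)
      = Poly_Mapping.single (\<Sum>i\<in>X. Poly_Mapping.single i (lookup a i)) 1" for X :: "'n set"
    by (induction X rule: infinite_finite_induct) (auto simp: var_power mult_single)
  moreover have "(\<Sum>i\<in>UNIV. Poly_Mapping.single i (lookup a i)) = a"
    by (rule poly_mapping_eqI) (simp add: lookup_sum lookup_single when_def)
  ultimately show ?thesis by simp
qed

text \<open>A diagonal matrix rescales each variable, so monomials are eigenvectors of the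
  torus.\<close>

lemma lin_subst_diagonal:
  assumes "\<And>i j. i \<noteq> j \<Longrightarrow> D $ i $ j = 0"
  shows "lin_subst D (Poly_Mapping.single a 1)
    = pm_scale (\<Prod>i\<in>UNIV. D $ i $ i ^ lookup a i) (Poly_Mapping.single a (1::'k::field))"
proof -
  have "(\<Sum>j\<in>UNIV. pm_scale (D $ i $ j) (var j)) = pm_scale (D $ i $ i) (var i :: (_, 'k) mpoly)" for i
    using assms by (subst sum.remove[of _ i]) auto
  moreover have "pm_scale c x ^ n = pm_scale (c ^ n) (x ^ n)" for c n and x :: "('a, 'k) mpoly"
    by (induction n) (auto simp: pm_scale_mult)
  moreover have "(\<Prod>i\<in>X. pm_scale (c i) (x i)) = pm_scale (\<Prod>i\<in>X. c i) (\<Prod>i\<in>X. x i)"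
    for c and x :: "'a \<Rightarrow> ('a, 'k) mpoly" and X
    by (induction X rule: infinite_finite_induct) (auto simp: pm_scale_mult)
  ultimately show ?thesis
    by (simp add: lin_subst_single flip: single_conv_prod_var)
qed

lemma lin_subst_mat_1 [simp]: "lin_subst (mat 1) f = f"
  by (subst lin_subst_expand) (simp add: lin_subst_diagonal mat_def poly_mapping_sum_single)

text \<open>A coordinate that occurs in \<open>l\<close> with nonzero coefficient can be exchanged
  for \<open>l\<close>, the other coordinates being kept.\<close>

lemma hyperplane_form_as_coordinate:
  fixes l :: "('n::finite, 'k::field) mpoly"
  assumes "hyperplane_form l"
  obtains B C :: "'k ^ 'n ^ 'n" and i where "B ** C = mat 1" "C ** B = mat 1" "lin_subst B (var i) = l"
proof -
  have l: "l \<in> hom_polys 1" "l \<noteq> 0" using assms by (auto simp: hyperplane_form_def)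
  define c where "c j = lookup l (Poly_Mapping.single j 1)" for j
  have keys: "keys l \<subseteq> range (\<lambda>j. Poly_Mapping.single j 1)"
  proof
    fix a assume "a \<in> keys l"
    then have "(\<Sum>i\<in>UNIV. lookup a i) = 1" using l(1) by (auto simp: hom_polys_def mdeg_def)
    then obtain j where "lookup a j = 1" "\<And>i. j \<noteq> i \<Longrightarrow> lookup a i = 0"
      using sum_eq_1_iff[of UNIV "lookup a"] by auto
    then have "a = Poly_Mapping.single j 1"
      by (intro poly_mapping_eqI) (auto simp: lookup_single when_def)
    then show "a \<in> range (\<lambda>j. Poly_Mapping.single j 1)" by blast
  qed
  have "inj (\<lambda>j::'n. Poly_Mapping.single j (1::nat))"
    by (rule injI) (metis lookup_single_eq lookup_single_not_eq zero_neq_one)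
  have "l = (\<Sum>a\<in>keys l. Poly_Mapping.single a (lookup l a))"
    by (simp add: poly_mapping_sum_single)
  also have "\<dots> = (\<Sum>a\<in>range (\<lambda>j. Poly_Mapping.single j 1). Poly_Mapping.single a (lookup l a))"
    using keys by (intro sum.mono_neutral_left) (auto simp: in_keys_iff)
  also have "\<dots> = (\<Sum>j\<in>UNIV. pm_scale (c j) (var j))"
    using \<open>inj _\<close> by (simp add: sum.reindex var_def c_def)
  finally have l_eq: "l = (\<Sum>j\<in>UNIV. pm_scale (c j) (var j))" .
  have "\<exists>i. c i \<noteq> 0"
  proof (rule ccontr)
    assume "\<nexists>i. c i \<noteq> 0"
    then have "(\<Sum>j\<in>UNIV. pm_scale (c j) (var j)) = (0 :: ('n, 'k) mpoly)" by simp
    with l_eq l(2) show False by argo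
  qed
  then obtain i where i: "c i \<noteq> 0" by blast
  define B :: "'k ^ 'n ^ 'n" where "B = (\<chi> k j. if k = i then c j else if k = j then 1 else 0)"
  \<comment> \<open>Row \<open>i\<close> solves for the old coordinate: \<open>x_i\<close> is
    \<open>l\<close> minus the other terms of \<open>l\<close>, divided by
    \<open>c i\<close>.\<close>
  define C :: "'k ^ 'n ^ 'n" where
    "C = (\<chi> k j. if k = i then (if j = i then 1 else - c j) / c i else if k = j then 1 else 0)"
  have CB: "C ** B = mat 1"
  proof -
    have "(\<Sum>k\<in>UNIV. C $ a $ k * B $ k $ b) = (if a = b then 1 else 0)" for a b
    proof -
      have off: "(\<Sum>k\<in>UNIV - {i}. C $ a $ k * B $ k $ b) = (\<Sum>k\<in>UNIV - {i}. if k = b then C $ a $ k else 0)"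
        by (rule sum.cong) (auto simp: B_def)
      have "(\<Sum>k\<in>UNIV. C $ a $ k * B $ k $ b)
          = C $ a $ i * c b + (\<Sum>k\<in>UNIV - {i}. if k = b then C $ a $ k else 0)"
        unfolding off[symmetric] by (subst sum.remove[of _ i]) (auto simp: B_def)
      also have "\<dots> = C $ a $ i * c b + (if b = i then 0 else C $ a $ b)"
        by simp
      also have "\<dots> = (if a = b then 1 else 0)"
        using i by (auto simp: C_def)
      finally show ?thesis .
    qed
    then show ?thesis by (simp add: matrix_matrix_mult_def mat_def)
  qed
  show ?thesis
  proof (rule that)
    show "B ** C = mat 1" using CB by (simp add: matrix_left_right_inverse)
    show "lin_subst B (var i) = l" by (simp add: lin_subst_var B_def l_eq)
  qed (rule CB)
qed

section \<open>Destabilization by a one-parameter subgroup\<close>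

text \<open>An algebraic substitute for tending to \<open>0\<close> as \<open>s\<close> does. The
  value at \<open>s = 0\<close> is left free because the one-parameter subgroup is only meaningful
  for \<open>s \<noteq> 0\<close>.\<close>

definition vanishing_poly_fun :: "('k::field \<Rightarrow> 'k) \<Rightarrow> bool"
  where "vanishing_poly_fun h \<longleftrightarrow> (\<exists>p. poly p 0 = 0 \<and> (\<forall>s. s \<noteq> 0 \<longrightarrow> h s = poly p s))"

lemma vanishing_poly_fun_zero: "vanishing_poly_fun (\<lambda>s. 0)"
  unfolding vanishing_poly_fun_def by (rule exI[of _ 0]) simp

lemma vanishing_poly_fun_add:
  assumes "vanishing_poly_fun f" "vanishing_poly_fun g"
  shows "vanishing_poly_fun (\<lambda>s. f s + g s)"
proof -
  obtain p q where "poly p 0 = 0" "\<forall>s. s \<noteq> 0 \<longrightarrow> f s = poly p s" "poly q 0 = 0" "\<forall>s. s \<noteq> 0 \<longrightarrow> g s = poly q s"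
    using assms unfolding vanishing_poly_fun_def by blast
  then show ?thesis unfolding vanishing_poly_fun_def by (intro exI[of _ "p + q"]) simp
qed

lemma vanishing_poly_fun_mult_poly:
  assumes "vanishing_poly_fun f"
  shows "vanishing_poly_fun (\<lambda>s. poly q s * f s)"
proof -
  obtain p where "poly p 0 = 0" "\<forall>s. s \<noteq> 0 \<longrightarrow> f s = poly p s"
    using assms unfolding vanishing_poly_fun_def by blast
  then show ?thesis unfolding vanishing_poly_fun_def by (intro exI[of _ "q * p"]) simp
qed

lemma vanishing_poly_fun_cmult: "vanishing_poly_fun f \<Longrightarrow> vanishing_poly_fun (\<lambda>s. c * f s)"
  using vanishing_poly_fun_mult_poly[of f "[:c:]"] by simp

lemma vanishing_poly_fun_mult:
  assumes "vanishing_poly_fun f" "vanishing_poly_fun g"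
  shows "vanishing_poly_fun (\<lambda>s. f s * g s)"
proof -
  obtain p where "\<forall>s. s \<noteq> 0 \<longrightarrow> f s = poly p s"
    using assms unfolding vanishing_poly_fun_def by blast
  with vanishing_poly_fun_mult_poly[OF assms(2), of p] show ?thesis
    by (simp add: vanishing_poly_fun_def)
qed

lemma vanishing_poly_fun_sum:
  assumes "\<And>x. x \<in> A \<Longrightarrow> vanishing_poly_fun (f x)"
  shows "vanishing_poly_fun (\<lambda>s. \<Sum>x\<in>A. f x s)"
  using assms by (induction A rule: infinite_finite_induct)
    (auto intro: vanishing_poly_fun_add vanishing_poly_fun_zero)

lemma vanishing_poly_fun_prod_list:
  assumes "vs \<noteq> []" "\<And>v. v \<in> set vs \<Longrightarrow> vanishing_poly_fun (f v)"
  shows "vanishing_poly_fun (\<lambda>s. \<Prod>v\<leftarrow>vs. f v s)"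
  using assms by (induction vs rule: list_nonempty_induct) (auto intro: vanishing_poly_fun_mult)

text \<open>A field of characteristic zero is infinite, so a polynomial equal to \<open>c\<close> at
  all nonzero arguments is the constant \<open>c\<close>, and its value at \<open>0\<close> is both
  \<open>c\<close> and \<open>0\<close>.\<close>

lemma vanishing_poly_fun_const:
  fixes c :: "'k::field_char_0"
  assumes "vanishing_poly_fun h" "\<And>s. s \<noteq> 0 \<Longrightarrow> h s = c"
  shows "c = 0"
proof -
  obtain p where p: "poly p 0 = 0" "\<And>s. s \<noteq> 0 \<Longrightarrow> poly p s = c"
    using assms unfolding vanishing_poly_fun_def by metis
  have "infinite (UNIV - {0 :: 'k})" by (simp add: infinite_UNIV_char_0)
  moreover have "UNIV - {0} \<subseteq> {s. poly (p - [:c:]) s = 0}" using p(2) by auto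
  ultimately have "p - [:c:] = 0"
    using poly_roots_finite finite_subset by blast
  then show "c = 0" using p(1) by (metis diff_eq_diff_eq diff_self eq_iff_diff_eq_0 poly_pCons poly_0 add.right_neutral mult_zero_left)
qed

text \<open>To be read with \<open>W = S\<^sub>m\<close>, \<open>U = I\<^sub>m\<close>, \<open>\<sigma>\<close> the one-parameter subgroup, \<open>Y\<close> its eigenvectors, and \<open>Q\<close>
  a linear form on the exterior power that represents the Hilbert point.\<close>

lemma multilinear_vanishing_poly_fun:
  fixes Q :: "('a \<Rightarrow>\<^sub>0 'k::field) list \<Rightarrow> 'k" and \<sigma> :: "'k \<Rightarrow> ('a \<Rightarrow>\<^sub>0 'k) \<Rightarrow> ('a \<Rightarrow>\<^sub>0 'k)"
  assumes W: "pm.subspace W" "W = pm.span Y"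
    and \<sigma>_add: "\<And>s u v. \<sigma> s (u + v) = \<sigma> s u + \<sigma> s v"
    and \<sigma>_scale: "\<And>s a u. \<sigma> s (pm_scale a u) = pm_scale a (\<sigma> s u)"
    and \<sigma>_W: "\<And>s u. u \<in> W \<Longrightarrow> \<sigma> s u \<in> W"
    and Q: "\<And>xs ys a b u v. xs @ u # ys \<in> tuples d W \<Longrightarrow> xs @ v # ys \<in> tuples d W \<Longrightarrow>
      Q (xs @ (pm_scale a u + pm_scale b v) # ys) = a * Q (xs @ u # ys) + b * Q (xs @ v # ys)"
    and Q_U: "\<And>xs ys u. xs @ u # ys \<in> tuples d W \<Longrightarrow> u \<in> U \<Longrightarrow> Q (xs @ u # ys) = 0"
    and Y: "\<And>y. y \<in> Y \<Longrightarrow> (\<forall>s. s \<noteq> 0 \<longrightarrow> \<sigma> s y \<in> U) \<or> (\<exists>e>0. \<forall>s. s \<noteq> 0 \<longrightarrow> \<sigma> s y = pm_scale (s ^ e) y)"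
    and xs: "xs \<in> tuples d W" and "d > 0"
  shows "vanishing_poly_fun (\<lambda>s. Q (map (\<sigma> s) xs))"
proof -
  \<comment> \<open>The vectors in \<open>pre\<close> are not moved by \<open>\<sigma>\<close>. The
    second conjunct is the form that survives when no moved vector is left: then the function is
    constant and need not vanish.\<close>
  have gen: "(xs \<noteq> [] \<longrightarrow> vanishing_poly_fun (\<lambda>s. Q (pre @ map (\<sigma> s) xs))) \<and>
      (\<exists>p. \<forall>s. s \<noteq> 0 \<longrightarrow> Q (pre @ map (\<sigma> s) xs) = poly p s)"
    if "pre @ xs \<in> tuples d W" for pre xs
    using that
  proof (induction xs arbitrary: pre)
    case Nil
    show ?case by (auto intro: exI[of _ "[:Q pre:]"])
  next
    case (Cons x xs)
    have tup: "pre @ u # map (\<sigma> s) xs \<in> tuples d W" if "u \<in> W" for u s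
      using Cons.prems that \<sigma>_W by (auto simp: tuples_def)
    define h where "h u s = Q (pre @ \<sigma> s u # map (\<sigma> s) xs)" for u s
    have h_lin: "h (pm_scale a u + pm_scale b v) s = a * h u s + b * h v s"
      if "u \<in> W" "v \<in> W" for a b u v s
      unfolding h_def \<sigma>_add \<sigma>_scale using that by (intro Q tup \<sigma>_W)
    have h_scale: "h (pm_scale a u) s = a * h u s" if "u \<in> W" for a u s
      using h_lin[OF that that, of a 0] by simp
    \<comment> \<open>By linearity in the first moved vector it suffices to treat the eigenvectors
      that span \<open>W\<close>.\<close>
    have "W \<subseteq> {u \<in> W. vanishing_poly_fun (h u)}"
      unfolding W(2)
    proof (rule pm.span_minimal)
      show "Y \<subseteq> {u \<in> pm.span Y. vanishing_poly_fun (h u)}"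
      proof (intro subsetI CollectI conjI)
        fix y assume y: "y \<in> Y"
        then show "y \<in> pm.span Y" by (rule pm.span_base)
        then have yW: "y \<in> W" using W(2) by simp
        from Y[OF y] show "vanishing_poly_fun (h y)"
        proof
          assume "\<forall>s. s \<noteq> 0 \<longrightarrow> \<sigma> s y \<in> U"
          then have "h y s = 0" if "s \<noteq> 0" for s
            using that unfolding h_def by (intro Q_U tup \<sigma>_W yW) auto
          then show ?thesis using vanishing_poly_fun_zero by (simp add: vanishing_poly_fun_def)
        next
          assume "\<exists>e>0. \<forall>s. s \<noteq> 0 \<longrightarrow> \<sigma> s y = pm_scale (s ^ e) y"
          then obtain e where e: "e > 0" "\<And>s. s \<noteq> 0 \<Longrightarrow> \<sigma> s y = pm_scale (s ^ e) y" by blast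
          have "(pre @ [y]) @ xs \<in> tuples d W" using Cons.prems yW by (auto simp: tuples_def)
          then obtain p where p: "\<And>s. s \<noteq> 0 \<Longrightarrow> Q ((pre @ [y]) @ map (\<sigma> s) xs) = poly p s"
            using Cons.IH by meson
          \<comment> \<open>The eigenvalue \<open>s ^ e\<close> is pulled out and \<open>y\<close>
            joins the fixed prefix. The remaining factor is polynomial by induction, and
            \<open>e > 0\<close> gives the zero at \<open>0\<close>.\<close>
          have "h y s = poly (monom 1 e * p) s" if "s \<noteq> 0" for s
            using Q[OF tup tup, OF yW yW, of "s ^ e" 0 s] e(2)[OF that] p[OF that]
            by (simp add: h_def poly_monom)
          moreover have "poly (monom 1 e * p) 0 = 0" using e(1) by (simp add: poly_monom)
          ultimately show ?thesis unfolding vanishing_poly_fun_def by blast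
        qed
      qed
      have "h 0 s = 0" for s using h_scale[of 0 0 s] W(1) by (simp add: pm.subspace_0)
      then have "h 0 = (\<lambda>s. 0)" by (rule ext)
      then have "vanishing_poly_fun (h 0)" by (simp add: vanishing_poly_fun_zero)
      moreover have "vanishing_poly_fun (h (u + v))"
        if "u \<in> W" "v \<in> W" "vanishing_poly_fun (h u)" "vanishing_poly_fun (h v)" for u v
      proof -
        have "h (u + v) = (\<lambda>s. h u s + h v s)" using h_lin[OF that(1,2), of 1 1] by (intro ext) simp
        then show ?thesis using vanishing_poly_fun_add[OF that(3,4)] by simp
      qed
      moreover have "vanishing_poly_fun (h (pm_scale a u))"
        if "u \<in> W" "vanishing_poly_fun (h u)" for a u
      proof -
        have "h (pm_scale a u) = (\<lambda>s. a * h u s)" using h_scale[OF that(1)] by (intro ext) simp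
        then show ?thesis using vanishing_poly_fun_cmult[OF that(2)] by simp
      qed
      ultimately show "pm.subspace {u \<in> pm.span Y. vanishing_poly_fun (h u)}"
        using W(1) unfolding W(2)[symmetric] pm.subspace_def by blast
    qed
    then have "vanishing_poly_fun (h x)" using Cons.prems by (auto simp: tuples_def)
    then show ?case by (auto simp: h_def vanishing_poly_fun_def)
  qed
  have "xs \<noteq> []" using xs \<open>d > 0\<close> by (auto simp: tuples_def)
  then show ?thesis using gen[of "[]" xs] xs by simp
qed

lemma linear_form_sum:
  assumes "Vector_Spaces.linear pm_scale (*) q"
  shows "q (lin_ext \<mu> f) = (\<Sum>a\<in>keys f. lookup f a * q (\<mu> a))"
proof -
  interpret Vector_Spaces.linear pm_scale "(*)" q by (rule assms)
  show ?thesis by (simp add: lin_ext_def sum scale)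
qed

text \<open>Along the orbit of the one-parameter subgroup an invariant \<open>F\<close> is constant,
  yet it is a sum of products of \<open>n > 0\<close> functions that vanish at \<open>s = 0\<close>.
  So \<open>F q = 0\<close>.\<close>

lemma thickening_not_semistable:
  fixes I :: "('n::finite, 'k::field_char_0) mpoly set"
  assumes N: "CARD('n) = N + 1" and id: "module.subspace (*) I"
    and l: "hyperplane_form l" "l ^ r \<in> I"
    and m: "m > (N + 1) * (r - 1)" and d: "d > 0"
  shows "\<not> git_semistable SL_action (wedge_free d (hom_polys m)) (wedge_rels d (hom_polys m) {0})
    (wedge_rels d (hom_polys m) (I \<inter> hom_polys m))"
proof
  define W where "W = (hom_polys m :: ('n, 'k) mpoly set)"
  assume "git_semistable SL_action (wedge_free d (hom_polys m)) (wedge_rels d (hom_polys m) {0})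
    (wedge_rels d (hom_polys m) (I \<inter> hom_polys m))"
  then obtain n F where n: "n > 0" and F: "F \<in> sym_power n (wedge_free d W)"
    and inv: "\<forall>g\<in>SL_action. \<forall>q\<in>linear_forms (wedge_rels d W {0}). F (q \<circ> g) = F q"
    and "\<exists>q\<in>linear_forms (wedge_rels d W {0}).
      {\<xi> \<in> wedge_free d W. q \<xi> = 0} = wedge_rels d W (I \<inter> W) \<and> F q \<noteq> 0"
    unfolding git_semistable_def W_def by blast
  then obtain q where q: "q \<in> linear_forms (wedge_rels d W {0})"
    and K: "{\<xi> \<in> wedge_free d W. q \<xi> = 0} = wedge_rels d W (I \<inter> W)" and Fq: "F q \<noteq> 0"
    by blast
  have lin: "Vector_Spaces.linear pm_scale (*) q" using q by (simp add: linear_forms_def)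
  interpret q: Vector_Spaces.linear pm_scale "(*)" q by (rule lin)
  obtain B C :: "'k ^ 'n ^ 'n" and i where BC: "B ** C = mat 1" "C ** B = mat 1"
    and Bi: "lin_subst B (var i) = l"
    using hyperplane_form_as_coordinate[OF l(1)] by metis
  \<comment> \<open>Weight \<open>-N\<close> on the coordinate that becomes \<open>l\<close> and
    weight \<open>1\<close> on the \<open>N\<close> others give determinant \<open>1\<close>;
    \<open>A s\<close> is the same subgroup in the original coordinates.\<close>
  define D :: "'k \<Rightarrow> 'k ^ 'n ^ 'n"
    where "D s = (\<chi> k j. if k = j then if k = i then inverse s ^ N else s else 0)" for s
  define A where "A s = C ** D s ** B" for s
  define Q where "Q xs = q (Poly_Mapping.single xs 1)" for xs
  \<comment> \<open>These are the monomials in the new coordinates, with \<open>l\<close> in the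
    place of \<open>var i\<close>.\<close>
  define Y where "Y = {lin_subst B (Poly_Mapping.single a 1) | a. mdeg a = m}"
  have det: "det (A s) = 1" if "s \<noteq> 0" for s
  proof -
    have "det (D s) = (\<Prod>k\<in>UNIV. if k = i then inverse s ^ N else s)"
      by (subst det_diagonal) (auto simp: D_def)
    also have "\<dots> = inverse s ^ N * s ^ N"
      using N by (subst prod.remove[of _ i]) (auto simp: card_Diff_singleton)
    also have "\<dots> = 1" using that by (simp flip: power_mult_distrib)
    finally show ?thesis
      using arg_cong[OF BC(1), of det] by (simp add: A_def det_mul mult.commute)
  qed
  have A_B: "lin_subst (A s) (lin_subst B f) = lin_subst B (lin_subst (D s) f)" for s f
    using BC(1) by (simp add: lin_subst_lin_subst A_def matrix_mul_assoc)
  have W_span: "W = pm.span Y"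
  proof (intro equalityI subsetI)
    fix f assume f: "f \<in> W"
    have "f = lin_subst B (lin_subst C f)" using BC by (simp add: lin_subst_lin_subst)
    also have "\<dots> = (\<Sum>a\<in>keys (lin_subst C f). pm_scale (lookup (lin_subst C f) a)
        (lin_subst B (Poly_Mapping.single a 1)))"
      by (rule lin_subst_expand)
    also have "\<dots> \<in> pm.span Y"
      using lin_subst_in_hom_polys[of f m C] f
      by (intro pm.span_sum pm.span_scale pm.span_base) (auto simp: Y_def W_def hom_polys_def)
    finally show "f \<in> pm.span Y" .
  next
    have "Poly_Mapping.single a (1::'k) \<in> hom_polys (mdeg a)" for a :: "'n \<Rightarrow>\<^sub>0 nat"
      by (simp add: hom_polys_def)
    then have "Y \<subseteq> W" by (auto simp: Y_def W_def intro: lin_subst_in_hom_polys)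
    then show "f \<in> W" if "f \<in> pm.span Y" for f
      using that pm.span_minimal[OF _ subspace_hom_polys] by (auto simp: W_def)
  qed
  have Q_lin: "Q (xs @ (pm_scale a u + pm_scale b v) # ys) = a * Q (xs @ u # ys) + b * Q (xs @ v # ys)"
    if "xs @ u # ys \<in> tuples d W" "xs @ v # ys \<in> tuples d W" for xs ys a b u v
  proof -
    have "Poly_Mapping.single (xs @ (pm_scale a u + pm_scale b v) # ys) 1
        - Poly_Mapping.single (xs @ u # ys) a - Poly_Mapping.single (xs @ v # ys) b \<in> wedge_rels d W {0}"
      using that unfolding wedge_rels_def by (intro pm.span_base) blast
    then have "q (Poly_Mapping.single (xs @ (pm_scale a u + pm_scale b v) # ys) 1
        - pm_scale a (Poly_Mapping.single (xs @ u # ys) 1)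
        - pm_scale b (Poly_Mapping.single (xs @ v # ys) 1)) = 0"
      using q by (simp add: linear_forms_def)
    then show ?thesis by (simp only: Q_def q.diff q.scale) (simp add: algebra_simps)
  qed
  \<comment> \<open>Modulo \<open>I\<close> the entry \<open>u\<close> may be replaced by
    \<open>0\<close>: the difference is a relation in the kernel defining the Hilbert point. An
    entry \<open>0\<close> gives value \<open>0\<close> by multilinearity.\<close>
  have Q_I: "Q (xs @ u # ys) = 0" if "xs @ u # ys \<in> tuples d W" "u \<in> I \<inter> W" for xs ys u
  proof -
    have 0: "xs @ 0 # ys \<in> tuples d W"
      using that(1) pm.subspace_0[OF subspace_hom_polys] by (auto simp: tuples_def W_def)
    have "Poly_Mapping.single (xs @ u # ys) 1 - Poly_Mapping.single (xs @ 0 # ys) 1 \<in> wedge_rels d W (I \<inter> W)"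
      unfolding wedge_rels_def 
      by (intro pm.span_base UnI2 CollectI exI[of _ xs] exI[of _ ys] exI[of _ u] exI[of _ 0] conjI refl)
        (use that 0 in auto)
    then have "q (Poly_Mapping.single (xs @ u # ys) 1 - Poly_Mapping.single (xs @ 0 # ys) 1) = 0"
      using K by blast
    then have "Q (xs @ u # ys) = Q (xs @ 0 # ys)" by (simp add: Q_def q.diff)
    then show ?thesis using Q_lin[OF 0 0, of 0 0] by simp
  qed
  have weights: "(\<forall>s. s \<noteq> 0 \<longrightarrow> lin_subst (A s) y \<in> I \<inter> W) \<or>
      (\<exists>e>0. \<forall>s. s \<noteq> 0 \<longrightarrow> lin_subst (A s) y = pm_scale (s ^ e) y)" if y: "y \<in> Y" for y
  proof -
    obtain a where a: "y = lin_subst B (Poly_Mapping.single a 1)" "mdeg a = m"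
      using y by (auto simp: Y_def)
    have Ay: "lin_subst (A s) y = pm_scale (\<Prod>k\<in>UNIV. D s $ k $ k ^ lookup a k) y" for s
      unfolding a(1) A_B by (subst lin_subst_diagonal) (auto simp: D_def lin_subst_scale simp del: pm_scale_single)
    show ?thesis
    proof (cases "r \<le> lookup a i")
      case True
      have "a = Poly_Mapping.single i r + (a - Poly_Mapping.single i r)"
        using True by (intro poly_mapping_eqI) (auto simp: lookup_add lookup_minus lookup_single when_def)
      then have "Poly_Mapping.single a (1::'k) = var i ^ r * Poly_Mapping.single (a - Poly_Mapping.single i r) 1"
        by (simp add: var_power mult_single)
      then have "y = l ^ r * lin_subst B (Poly_Mapping.single (a - Poly_Mapping.single i r) 1)"
        by (simp add: a(1) lin_subst_mult lin_subst_power Bi)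
      then have "y \<in> I" using ideal_mult(2)[OF id l(2)] by simp
      then have "lin_subst (A s) y \<in> I" for s
        using ideal_mult(1)[OF id] by (simp add: Ay pm_scale_conv_mult)
      moreover have "y \<in> W" using y W_span pm.span_base by blast
      ultimately show ?thesis using lin_subst_in_hom_polys by (auto simp: W_def)
    next
      case False
      \<comment> \<open>Here \<open>lookup a i < r\<close>, so \<open>r\<close> is positive and the
        natural subtraction \<open>r - 1\<close> is not truncated. The bound on \<open>m\<close>
        then makes the weight \<open>e\<close> positive.\<close>
      then have "(N + 1) * lookup a i \<le> (N + 1) * (r - 1)" by (intro mult_le_mono2) auto
      then have lt: "(N + 1) * lookup a i < m" using m by linarith
      define e where "e = m - (N + 1) * lookup a i"
      have sum: "m = lookup a i + (\<Sum>k\<in>UNIV - {i}. lookup a k)"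
        unfolding a(2)[symmetric] mdeg_def by (rule sum.remove) auto
      have "(\<Prod>k\<in>UNIV. D s $ k $ k ^ lookup a k) = s ^ e" if "s \<noteq> 0" for s
      proof -
        have "(\<Prod>k\<in>UNIV. D s $ k $ k ^ lookup a k)
            = (inverse s ^ N) ^ lookup a i * (\<Prod>k\<in>UNIV - {i}. s ^ lookup a k)"
          by (subst prod.remove[of _ i]) (auto simp: D_def)
        \<comment> \<open>The other exponents add up to \<open>m - lookup a i\<close>, which is
          \<open>e + N * lookup a i\<close>; the second summand cancels against the negative weight
          of \<open>l\<close>.\<close>
        also have "(\<Prod>k\<in>UNIV - {i}. s ^ lookup a k) = s ^ (e + N * lookup a i)"
          using sum lt by (simp add: e_def flip: power_sum)
        also have "(inverse s ^ N) ^ lookup a i * s ^ (e + N * lookup a i)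
            = s ^ e * (inverse s * s) ^ (N * lookup a i)"
          by (simp add: power_add power_mult_distrib flip: power_mult)
        finally show ?thesis using that by simp
      qed
      moreover have "e > 0" using lt by (simp add: e_def)
      ultimately show ?thesis using Ay by auto
    qed
  qed
  have tuple: "vanishing_poly_fun (\<lambda>s. Q (map (lin_subst (A s)) xs))" if "xs \<in> tuples d W" for xs
  proof (rule multilinear_vanishing_poly_fun[where W = W and Y = Y and U = "I \<inter> W" and d = d])
    show "pm.subspace W" by (simp add: W_def subspace_hom_polys)
    show "u \<in> W \<Longrightarrow> lin_subst (A s) u \<in> W" for s u by (simp add: W_def lin_subst_in_hom_polys)
  qed (fact W_span lin_subst_add lin_subst_scale Q_lin Q_I weights that d)+
  \<comment> \<open>Elements of the free space are linear combinations of tuples, so the vanishing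
    at \<open>s = 0\<close> passes to them.\<close>
  have vec: "vanishing_poly_fun (\<lambda>s. q (push (map (lin_subst (A s))) v))" if "v \<in> wedge_free d W" for v
    using that tuple unfolding push_conv_lin_ext linear_form_sum[OF lin] Q_def[symmetric]
    by (intro vanishing_poly_fun_sum vanishing_poly_fun_cmult) (auto simp: wedge_free_def)
  obtain c where c: "F = (\<lambda>q. \<Sum>vs\<in>keys c. lookup c vs * (\<Prod>v\<leftarrow>vs. q v))"
    "keys c \<subseteq> tuples n (wedge_free d W)"
    using F by (auto simp: sym_power_def)
  have "vanishing_poly_fun (\<lambda>s. \<Sum>vs\<in>keys c. lookup c vs * (\<Prod>v\<leftarrow>vs. q (push (map (lin_subst (A s))) v)))"
  proof (intro vanishing_poly_fun_sum vanishing_poly_fun_cmult vanishing_poly_fun_prod_list)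
    fix vs assume "vs \<in> keys c"
    then have "vs \<in> tuples n (wedge_free d W)" using c(2) by blast
    then show "vs \<noteq> []" "\<And>v. v \<in> set vs \<Longrightarrow> vanishing_poly_fun (\<lambda>s. q (push (map (lin_subst (A s))) v))"
      using n vec by (auto simp: tuples_def)
  qed
  then have "vanishing_poly_fun (\<lambda>s. F (q \<circ> push (map (lin_subst (A s)))))"
    by (simp add: c(1) comp_def)
  moreover have "F (q \<circ> push (map (lin_subst (A s)))) = F q" if "s \<noteq> 0" for s
    using det[OF that] by (intro inv[rule_format] q) (auto simp: SL_action_def)
  ultimately show False using vanishing_poly_fun_const Fq by blast
qed

theorem lemma1:
  fixes I :: "('n::finite, 'k::{alg_closed_field, field_char_0}) mpoly set" and N :: nat
  assumes "CARD('n) = N + 1"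
    and "closed_subscheme I"
    and "proj_points I \<noteq> {}"
  shows "(\<forall>r m. r \<ge> 1 \<longrightarrow> (\<exists>l. hyperplane_form l \<and> in_thickening I l r) \<longrightarrow>
            m > 0 \<longrightarrow> m > (N + 1) * (r - 1) \<longrightarrow> hilbert_point_defined I m \<longrightarrow>
            hilbert_unstable I m) \<and>
         (reduced_scheme I \<longrightarrow> degenerate I \<longrightarrow>
            (\<forall>m. m > 0 \<longrightarrow> hilbert_point_defined I m \<longrightarrow> hilbert_unstable I m))"
proof -
  have I: "homogeneous_ideal I" using assms(2) by (simp add: closed_subscheme_def)
  then have id: "module.subspace (*) I" by (simp add: homogeneous_ideal_def)
  have unstable: "hilbert_unstable I m"
    if l: "hyperplane_form l" "l ^ r \<in> I" "m > (N + 1) * (r - 1)" and m: "hilbert_point_defined I m" for l r m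
  proof -
    obtain d where d: "has_quot_dim tuple_scale (twist_sections I m) (twist_null I m) d"
      "of_nat d = poly (hilbert_polynomial I) (of_nat m)"
      using m unfolding hilbert_point_defined_def by blast
    \<comment> \<open>The value of the Hilbert polynomial at \<open>m\<close> is the dimension
      \<open>d\<close> of the space of global sections, so the floor returns \<open>d\<close>
      itself.\<close>
    have "hilbert_value I m = d" by (simp add: hilbert_value_def flip: d(2))
    moreover have "d > 0" by (rule global_sections_nonzero[OF I assms(3) d(1)])
    ultimately show ?thesis
      unfolding hilbert_unstable_def hilbert_point_def
      using thickening_not_semistable[OF assms(1) id l] by simp
  qed
  show ?thesis
  proof (intro conjI allI impI)
    show "hilbert_unstable I m"
      if "\<exists>l. hyperplane_form l \<and> in_thickening I l r" "m > (N + 1) * (r - 1)" "hilbert_point_defined I m"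
      for r m
      using that unstable by (auto simp: in_thickening_def)
    assume "reduced_scheme I" "degenerate I"
    \<comment> \<open>For exponent \<open>1\<close> the bound \<open>(N + 1) * (1 - 1)\<close> is
      \<open>0\<close>, so every positive \<open>m\<close> is covered.\<close>
    then obtain l where "hyperplane_form l" "l ^ 1 \<in> I"
      using reduced_degenerate_in_hyperplane[OF assms(2)] by (metis power_one_right)
    then show "hilbert_unstable I m" if "m > 0" "hilbert_point_defined I m" for m
      using unstable[of l 1 m] that by simp
  qed
qed

end
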